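(* Let $-1<q\le1$ and let $\rho_{12},\rho_{13},\rho_{23}\in(-1,1)$ satisfy $1+2\rho_{12}\rho_{13}\rho_{23}-\rho_{12}^2-\rho_{13}^2-\rho_{23}^2\ge0$. Then for all $x_1,x_2,x_3\in S(q)$ $$\sum_{s=0}^\infty\frac{\rho_{12}^s(\rho_{13}\rho_{23}/\rho_{12})_s}{[s]_q!\,(\rho_{13}^2,\rho_{23}^2)_s}P_s(x_1|x_3,\rho_{13},q)P_s(x_2|x_3,\rho_{23},q)=\frac{f_{CN}(x_1|x_2,\rho_{12},q)}{f_{CN}(x_1|x_3,\rho_{13},q)}\sum_{k\ge0}\frac{\rho_{13}^k(\rho_{12}\rho_{23}/\rho_{13})_k}{[k]_q!\,(\rho_{12}^2,\rho_{23}^2)_k}P_k(x_1|x_2,\rho_{12},q)P_k(x_3|x_2,\rho_{23},q).$$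
   Context: Notation, for $-1<q\le1$: $[0]_q=0$, $[n]_q=1+q+\dots+q^{n-1}$, $[n]_q!=\prod_{i=1}^n[i]_q$, $[0]_q!=1$; $(a)_n=\prod_{i=0}^{n-1}(1-aq^i)$, $(a)_0=1$, $(a,b)_n=(a)_n(b)_n$, and, for $|q|<1$, $(a)_\infty=\prod_{i\ge0}(1-aq^i)$. The expression $c^s(a/c)_s$ is always read as $\prod_{i=0}^{s-1}(c-aq^i)$ (so it makes sense for $c=0$). $S(q)=[-2/\sqrt{1-q},2/\sqrt{1-q}]$ for $|q|<1$, $S(1)=\mathbb R$. Al-Salam–Chihara polynomials: $P_{-1}=0$, $P_0=1$, $P_{n+1}(x|y,\rho,q)=(x-\rho yq^n)P_n(x|y,\rho,q)-(1-\rho^2q^{n-1})[n]_qP_{n-1}(x|y,\rho,q)$, $n\ge0$. Densities, for $|q|<1$, $x,y\in S(q)$, $|\rho|<1$: $$f_N(x|q)=\frac{(q)_\infty\sqrt{1-q}}{2\pi}\sqrt{4-(1-q)x^2}\prod_{k=1}^\infty\big((1+q^k)^2-(1-q)x^2q^k\big),\qquad f_{CN}(x|y,\rho,q)=f_N(x|q)\,(\rho^2)_\infty\prod_{k=0}^\infty\frac1{v_0(x,y|\rho q^k,q)},$$ where $v_0(x,y|\rho,q)=(1-\rho^2)^2-(1-q)\rho(1+\rho^2)xy+(1-q)\rho^2(x^2+y^2)$. For $q=1$: $f_{CN}(x|y,\rho,1)=\frac1{\sqrt{2\pi(1-\rho^2)}}\exp\left(-\frac{(x-\rho y)^2}{2(1-\rho^2)}\right)$.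 In the ratio $f_{CN}(x|y,\rho,q)/f_{CN}(x|z,\rho',q)$ the common factor $f_N(x|q)$ is cancelled, so it makes sense also at the endpoints of $S(q)$.
   Formalization: For q=1 with 1+2ρ12ρ13ρ23−ρ12²−ρ13²−ρ23²=0 the identity is stated only if both series converge, since they can diverge there (e.g. all ρ=−1/2, all x=0); in all other cases convergence and the identity are both asserted. *)

theory Defs
  imports "HOL-Analysis.Analysis"
begin

definition q_bracket :: "nat \<Rightarrow> real \<Rightarrow> real" where
  "q_bracket n q = (\<Sum>i<n. q ^ i)"

definition q_fact :: "nat \<Rightarrow> real \<Rightarrow> real" where
  "q_fact n q = (\<Prod>i=1..n. q_bracket i q)"

definition q_poch :: "real \<Rightarrow> nat \<Rightarrow> real \<Rightarrow> real" where
  "q_poch a n q = (\<Prod>i<n. 1 - a * q ^ i)"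

definition q_poch_inf :: "real \<Rightarrow> real \<Rightarrow> real" where
  "q_poch_inf a q = (\<Prod>i. 1 - a * q ^ i)"

(* The expression c^s (a/c)_s, read as a product so that c = 0 is allowed. *)
definition q_poch_hom :: "real \<Rightarrow> real \<Rightarrow> nat \<Rightarrow> real \<Rightarrow> real" where
  "q_poch_hom c a s q = (\<Prod>i<s. c - a * q ^ i)"

lemma q_poch_hom_eq: "c \<noteq> 0 \<Longrightarrow> q_poch_hom c a s q = c ^ s * q_poch (a / c) s q"
  by (induction s) (simp_all add: q_poch_hom_def q_poch_def field_simps)

definition q_support :: "real \<Rightarrow> real set" where
  "q_support q = (if q = 1 then UNIV else {- 2 / sqrt (1 - q) .. 2 / sqrt (1 - q)})"

(* Al-Salam--Chihara polynomials P_n(x|y,rho,q).  The index -1 of the usual recurrence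
   (P_{-1} = 0) only occurs in the step from 0 to 1, which is written out. *)
fun al_salam_chihara :: "nat \<Rightarrow> real \<Rightarrow> real \<Rightarrow> real \<Rightarrow> real \<Rightarrow> real" where
  "al_salam_chihara 0 x y \<rho> q = 1"
| "al_salam_chihara (Suc 0) x y \<rho> q = x - \<rho> * y"
| "al_salam_chihara (Suc (Suc n)) x y \<rho> q =
     (x - \<rho> * y * q ^ Suc n) * al_salam_chihara (Suc n) x y \<rho> q
     - (1 - \<rho>\<^sup>2 * q ^ n) * q_bracket (Suc n) q * al_salam_chihara n x y \<rho> q"

definition v0 :: "real \<Rightarrow> real \<Rightarrow> real \<Rightarrow> real \<Rightarrow> real" where
  "v0 x y \<rho> q = (1 - \<rho>\<^sup>2)\<^sup>2 - (1 - q) * \<rho> * (1 + \<rho>\<^sup>2) * x * y + (1 - q) * \<rho>\<^sup>2 * (x\<^sup>2 + y\<^sup>2)"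

(* The q-Normal density; only meaningful for \<bar>q\<bar> < 1. *)
definition f_N :: "real \<Rightarrow> real \<Rightarrow> real" where
  "f_N x q = q_poch_inf q q * sqrt (1 - q) / (2 * pi) * sqrt (4 - (1 - q) * x\<^sup>2)
     * (\<Prod>k. (1 + q ^ Suc k)\<^sup>2 - (1 - q) * x\<^sup>2 * q ^ Suc k)"

(* The factor f_CN(x|y,rho,q) / f_N(x|q) of the conditional density, for \<bar>q\<bar> < 1. *)
definition f_CN_factor :: "real \<Rightarrow> real \<Rightarrow> real \<Rightarrow> real \<Rightarrow> real" where
  "f_CN_factor x y \<rho> q = q_poch_inf (\<rho>\<^sup>2) q * (\<Prod>k. 1 / v0 x y (\<rho> * q ^ k) q)"

definition f_CN :: "real \<Rightarrow> real \<Rightarrow> real \<Rightarrow> real \<Rightarrow> real" where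
  "f_CN x y \<rho> q =
     (if q = 1 then 1 / sqrt (2 * pi * (1 - \<rho>\<^sup>2)) * exp (- ((x - \<rho> * y)\<^sup>2 / (2 * (1 - \<rho>\<^sup>2))))
      else f_N x q * f_CN_factor x y \<rho> q)"

(* The quotient f_CN(x|y,rho,q) / f_CN(x|z,rho',q).  For q < 1 the common factor f_N(x|q)
   is cancelled, because it vanishes at the endpoints of the support. *)
definition f_CN_ratio :: "real \<Rightarrow> real \<Rightarrow> real \<Rightarrow> real \<Rightarrow> real \<Rightarrow> real \<Rightarrow> real" where
  "f_CN_ratio x y \<rho> z \<rho>' q =
     (if q = 1 then f_CN x y \<rho> q / f_CN x z \<rho>' q
      else f_CN_factor x y \<rho> q / f_CN_factor x z \<rho>' q)"

lemma f_N_nonzero: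
  assumes q: "\<bar>q\<bar> < 1" and x: "x \<in> {- 2 / sqrt (1 - q) <..< 2 / sqrt (1 - q)}"
  shows "f_N x q \<noteq> 0"
proof -
  have s: "summable (\<lambda>k. \<bar>q\<bar> ^ k)" using q by (simp add: summable_geometric)
  have pw: "\<bar>q ^ Suc k\<bar> < 1" for k
    using q power_less_one_iff[of "\<bar>q\<bar>" "Suc k"] by (simp add: power_abs del: power_Suc)
  have "\<bar>x\<bar> < 2 / sqrt (1 - q)" using x by auto
  hence "\<bar>x\<bar> * sqrt (1 - q) < 2" using q by (simp add: field_simps)
  hence "(\<bar>x\<bar> * sqrt (1 - q))\<^sup>2 < 2\<^sup>2" using q by (intro power_strict_mono) auto
  hence c: "(1 - q) * x\<^sup>2 < 4" using q by (simp add: power_mult_distrib mult.commute)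
  have c0: "0 \<le> (1 - q) * x\<^sup>2" using q by simp
  define C where "C = (1 - q) * x\<^sup>2"
  have nz: "(1 + r)\<^sup>2 - C * r \<noteq> 0" if "\<bar>r\<bar> < 1" for r :: real
  proof (cases "r \<le> 0")
    case True
    have "(1 + r)\<^sup>2 > 0" using that by auto
    moreover have "C * r \<le> 0" using True c0 by (simp add: C_def mult_nonneg_nonpos)
    ultimately show ?thesis by linarith
  next
    case False
    hence "C * r < 4 * r" using c by (simp add: C_def)
    moreover have "(1 + r)\<^sup>2 - 4 * r = (1 - r)\<^sup>2" by (simp add: power2_eq_square algebra_simps)
    ultimately show ?thesis by (smt (verit) zero_le_power2)
  qed
  have "summable (\<lambda>k. norm (1 - q * q ^ k - 1))"
    using summable_mult[OF s, of "\<bar>q\<bar>"] by (simp add: abs_mult power_abs)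
  hence "convergent_prod (\<lambda>k. 1 - q * q ^ k)"
    by (intro abs_convergent_prod_imp_convergent_prod)
       (simp add: abs_convergent_prod_conv_summable)
  hence 1: "q_poch_inf q q \<noteq> 0" unfolding q_poch_inf_def
  proof (rule prodinf_nonzero)
    show "1 - q * q ^ k \<noteq> 0" for k using pw[of k] by auto
  qed
  have "summable (\<lambda>k. norm ((1 + q ^ Suc k)\<^sup>2 - C * q ^ Suc k - 1))"
  proof (rule summable_comparison_test[OF _ summable_mult[OF s, of "3 + \<bar>C\<bar>"]], intro exI allI impI)
    fix k
    define r where "r = q ^ Suc k"
    have r: "\<bar>r\<bar> \<le> \<bar>q\<bar> ^ k" "\<bar>r\<bar> < 1"
      using q pw[of k] by (auto simp: r_def abs_mult power_abs intro: mult_left_le_one_le)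
    have "(1 + r)\<^sup>2 - C * r - 1 = r * (2 + r - C)" by (simp add: power2_eq_square algebra_simps)
    hence "\<bar>(1 + r)\<^sup>2 - C * r - 1\<bar> = \<bar>r\<bar> * \<bar>2 + r - C\<bar>" by (simp add: abs_mult)
    also have "\<dots> \<le> \<bar>q\<bar> ^ k * (3 + \<bar>C\<bar>)" using r by (intro mult_mono) auto
    finally show "norm (norm ((1 + q ^ Suc k)\<^sup>2 - C * q ^ Suc k - 1)) \<le> (3 + \<bar>C\<bar>) * \<bar>q\<bar> ^ k"
      by (simp add: r_def mult.commute)
  qed
  hence "convergent_prod (\<lambda>k. (1 + q ^ Suc k)\<^sup>2 - C * q ^ Suc k)"
    by (intro abs_convergent_prod_imp_convergent_prod)
       (simp add: abs_convergent_prod_conv_summable)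
  hence 2: "(\<Prod>k. (1 + q ^ Suc k)\<^sup>2 - C * q ^ Suc k) \<noteq> 0"
    using nz[OF pw] by (intro prodinf_nonzero) auto
  from 1 2 c q show ?thesis unfolding f_N_def C_def by simp
qed

lemma f_CN_ratio_eq:
  assumes "q = 1 \<or> f_N x q \<noteq> 0"
  shows "f_CN_ratio x y \<rho> z \<rho>' q = f_CN x y \<rho> q / f_CN x z \<rho>' q"
  using assms by (auto simp: f_CN_ratio_def f_CN_def)

(* General term of the series on the left-hand side of the identity; the series on the
   right-hand side has the same term with the indices 2 and 3 exchanged. *)
definition asc_term ::
  "real \<Rightarrow> real \<Rightarrow> real \<Rightarrow> real \<Rightarrow> real \<Rightarrow> real \<Rightarrow> real \<Rightarrow> nat \<Rightarrow> real" where
  "asc_term \<rho>12 \<rho>13 \<rho>23 x1 x2 x3 q s =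
     q_poch_hom \<rho>12 (\<rho>13 * \<rho>23) s q / (q_fact s q * (q_poch (\<rho>13\<^sup>2) s q * q_poch (\<rho>23\<^sup>2) s q))
     * al_salam_chihara s x1 x3 \<rho>13 q * al_salam_chihara s x2 x3 \<rho>23 q"

end

theory Submission
  imports Defs
begin

text \<open>Write \<open>H\<^sub>n(x)\<close> for the continuous q-Hermite polynomials, the Al-Salam--Chihara polynomials with
\<open>\<rho> = 0\<close>. For \<open>q < 1\<close> the identity is a symmetry. Both series are, up to explicit factors, the
q-Kibble-Slepian series
\[ K = \sum_{a,b,c} \frac{\rho_{12}^a \rho_{13}^b \rho_{23}^c}{[a]_q!\,[b]_q!\,[c]_q!}
   H_{a+b}(x_1) H_{a+c}(x_2) H_{b+c}(x_3), \]
which does not change when the indices 2 and 3 are exchanged.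

The link is the shifted Mehler sum \<open>G\<^sub>k = (\<Sum>n. \<rho>^n / [n]! * H\<^sub>n\<^sub>+\<^sub>k(x) * H\<^sub>n(y))\<close>. The three-term recurrence
of the \<open>H\<^sub>n\<close>, applied once in \<open>x\<close> and once in \<open>y\<close>, yields a three-term recurrence of \<open>G\<^sub>k\<close> in \<open>k\<close>. It is
the Al-Salam--Chihara recurrence in disguise, so that \<open>P\<^sub>k(x|y,\<rho>) * G\<^sub>0 = (\<rho>\<^sup>2)\<^sub>k * G\<^sub>k\<close>
(\<open>al_salam_chihara_mehler_sum\<close>). The same recurrence at \<open>k = 0, 1\<close> turns into a q-difference equation
for \<open>G\<^sub>0\<close> as a function of \<open>\<rho>\<close>, whose solution is the density quotient \<open>f_CN_factor\<close> (\<open>q_mehler\<close>).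

Hence the product \<open>f_CN_factor x1 x3 \<rho>13 q * f_CN_factor x2 x3 \<rho>23 q\<close>, multiplied by the \<open>s\<close>-th term of the
left-hand series, is \<open>q_poch_hom \<rho>12 (\<rho>13 * \<rho>23) s q / [s]!\<close> times a product of two Mehler sums, that is, a
double series containing \<open>H\<^sub>m(x3) * H\<^sub>n(x3)\<close>. Linearizing this product (\<open>q_hermite_linearization\<close>) and
resumming the coefficients by the q-binomial theorem (\<open>q_newton_expansion\<close>) gives exactly \<open>K\<close>
(\<open>asc_series_kibble_slepian\<close>). All rearrangements take place in one absolutely convergent fourfold series
(\<open>kibble_slepian_refined\<close>). The factor with indices 2 and 3 is symmetric and cancels.

For \<open>q = 1\<close> the series \<open>K\<close> need not converge absolutely. There the two series are ordinary Mehler kernels in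
standardized variables, with a partial correlation coefficient as their parameter. The recurrence of the
\<open>G\<^sub>k\<close> now gives a differential equation for \<open>G\<^sub>0\<close>, hence the classical closed form (\<open>mehler_formula\<close>); if the
Gram determinant is positive, then the left-hand series is the quotient of the normal densities of \<open>x1\<close> given \<open>x2\<close> and \<open>x3\<close>
and of \<open>x1\<close> given \<open>x3\<close>, and the identity follows because the numerator is symmetric in the indices 2 and 3.
If the determinant is zero, the partial correlations are \<open>1\<close> or \<open>-1\<close>. Abel's limit theorem then shows
that a convergent series has the sum zero (\<open>mehler_sum_boundary\<close>), and both sides of the identity vanish.\<close>

section \<open>Geometric growth bounds\<close>

text \<open>The finitely many indices at which the inequality may fail are absorbed by the constant.\<close>

lemma eventually_geometric_bound:
  fixes M :: "nat \<Rightarrow> real"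
  assumes "eventually (\<lambda>n. M (Suc n) \<le> R * M n) sequentially" "R > 0"
  shows "\<exists>C>0. \<forall>n. M n \<le> C * R ^ n"
proof -
  obtain N where N: "\<And>n. n \<ge> N \<Longrightarrow> M (Suc n) \<le> R * M n"
    using assms(1) by (auto simp: eventually_sequentially)
  define B where "B = Max ((\<lambda>n. M n / R ^ n) ` {..N})"
  have B: "M n / R ^ n \<le> B" if "n \<le> N" for n
    unfolding B_def using that by (intro Max_ge) auto
  have le: "M n \<le> B * R ^ n" for n
  proof (induction n)
    case 0
    show ?case using B[of 0] by simp
  next
    case (Suc n)
    show ?case
    proof (cases "Suc n \<le> N")
      case True
      show ?thesis using B[OF True] assms(2) by (simp add: field_simps)
    next
      case False
      have "M (Suc n) \<le> R * M n" using N False by simp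
      also have "\<dots> \<le> R * (B * R ^ n)" using Suc.IH assms(2) by simp
      finally show ?thesis by (simp add: mult_ac)
    qed
  qed
  have "B * R ^ n \<le> (\<bar>B\<bar> + 1) * R ^ n" for n
    using assms(2) by (intro mult_right_mono) auto
  hence "\<forall>n. M n \<le> (\<bar>B\<bar> + 1) * R ^ n" using le order_trans by blast
  thus ?thesis by (intro exI[of _ "\<bar>B\<bar> + 1"]) auto
qed

text \<open>The convergence of all the Hermite series below rests on bounds of this shape: the geometric decay of the powers of a
correlation leaves room for a growth rate \<open>R\<close> that is slightly too large.\<close>

lemma prod_le_geometric:
  fixes f :: "nat \<Rightarrow> real"
  assumes "f \<longlonglongrightarrow> L" "\<bar>L\<bar> < R"
  shows "\<exists>C>0. \<forall>n. \<bar>\<Prod>i<n. f i\<bar> \<le> C * R ^ n"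
proof (rule eventually_geometric_bound)
  have "(\<lambda>i. \<bar>f i\<bar>) \<longlonglongrightarrow> \<bar>L\<bar>" using assms(1) by (rule tendsto_rabs)
  hence "eventually (\<lambda>i. \<bar>f i\<bar> < R) sequentially" using assms(2) by (rule order_tendstoD)
  thus "eventually (\<lambda>n. \<bar>\<Prod>i<Suc n. f i\<bar> \<le> R * \<bar>\<Prod>i<n. f i\<bar>) sequentially"
  proof eventually_elim
    case (elim n)
    hence "\<bar>f n\<bar> * \<bar>\<Prod>i<n. f i\<bar> \<le> R * \<bar>\<Prod>i<n. f i\<bar>" by (intro mult_right_mono) auto
    thus ?case by (simp add: abs_mult mult.commute)
  qed
  show "R > 0" using assms(2) by linarith
qed

text \<open>Without \<open>\<alpha>\<close> and \<open>\<beta>\<close> this is the recurrence of the Chebyshev polynomials at \<open>c = cos \<phi>\<close>, whose characteristic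
roots \<open>z\<close> and \<open>cnj z\<close> have modulus 1. The defect \<open>a n = p (n + 1) - z * p n\<close> splits the recurrence into two steps of first
order, each with a multiplier of modulus 1. The potential \<open>K * norm (a n) + \<bar>p n\<bar>\<close> weights the
defect so heavily that its feedback into \<open>p\<close> costs a factor of only \<open>1 + 1 / K\<close>, and vanishing perturbations
do not spoil this. At \<open>\<bar>c\<bar> = 1\<close>, which is attained at the endpoints of the support, the two roots coincide and the unperturbed
solutions grow linearly; a rate \<open>R > 1\<close> covers this case as well.\<close>

lemma perturbed_chebyshev_growth:
  fixes p \<alpha> \<beta> :: "nat \<Rightarrow> real" and c R :: real
  assumes rec: "\<And>n. p (Suc (Suc n)) = (2 * c - \<alpha> n) * p (Suc n) - (1 - \<beta> n) * p n"
    and lim: "\<alpha> \<longlonglongrightarrow> 0" "\<beta> \<longlonglongrightarrow> 0"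
    and c: "\<bar>c\<bar> \<le> 1" and R: "R > 1"
  shows "\<exists>C>0. \<forall>n. \<bar>p n\<bar> \<le> C * R ^ n"
proof -
  define z where "z = Complex c (sqrt (1 - c\<^sup>2))"
  have c2: "c\<^sup>2 \<le> 1" using c by (simp add: abs_square_le_1)
  have nz: "norm z = 1" using c2 by (simp add: z_def cmod_def)
  have zc: "cnj z * z = 1" using c2 by (simp add: z_def complex_eq_iff power2_eq_square)
  have zs: "2 * complex_of_real c = z + cnj z" by (simp add: z_def complex_eq_iff)
  define a where "a n = complex_of_real (p (Suc n)) - z * of_real (p n)" for n
  \<comment> \<open>Chosen so that \<open>1 + 1 / K\<close> lies halfway between 1 and \<open>R\<close>, leaving room for the perturbations.\<close>
  define K where "K = 2 / (R - 1)"
  have K: "K > 0" "1 / K = (R - 1) / 2" using R by (auto simp: K_def)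
  define M where "M n = K * norm (a n) + \<bar>p n\<bar>" for n
  have arec: "a (Suc n) = cnj z * a n - of_real (\<alpha> n) * of_real (p (Suc n)) + of_real (\<beta> n) * of_real (p n)" for n
  proof -
    have "a (Suc n) = (2 * of_real c - of_real (\<alpha> n) - z) * of_real (p (Suc n)) - (1 - of_real (\<beta> n)) * of_real (p n)"
      by (simp add: a_def rec algebra_simps)
    also have "\<dots> = cnj z * of_real (p (Suc n)) - (cnj z * z) * of_real (p n) - of_real (\<alpha> n) * of_real (p (Suc n)) + of_real (\<beta> n) * of_real (p n)"
      unfolding zs zc by (simp add: algebra_simps)
    finally show ?thesis by (simp add: a_def algebra_simps)
  qed
  have pS: "\<bar>p (Suc n)\<bar> \<le> norm (a n) + \<bar>p n\<bar>" for n
  proof -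
    have "complex_of_real (p (Suc n)) = a n + z * of_real (p n)" by (simp add: a_def)
    hence "norm (complex_of_real (p (Suc n))) \<le> norm (a n) + norm (z * of_real (p n))"
      using norm_triangle_ineq by metis
    thus ?thesis by (simp add: norm_mult nz)
  qed
  have aS: "norm (a (Suc n)) \<le> (1 + \<bar>\<alpha> n\<bar>) * norm (a n) + (\<bar>\<alpha> n\<bar> + \<bar>\<beta> n\<bar>) * \<bar>p n\<bar>" for n
  proof -
    have "norm (a (Suc n)) \<le> norm (cnj z * a n) + norm (of_real (\<alpha> n) * complex_of_real (p (Suc n)))
         + norm (of_real (\<beta> n) * complex_of_real (p n))"
      unfolding arec by (meson norm_triangle_ineq norm_triangle_ineq4 order_trans add_right_mono)
    also have "\<dots> = norm (a n) + \<bar>\<alpha> n\<bar> * \<bar>p (Suc n)\<bar> + \<bar>\<beta> n\<bar> * \<bar>p n\<bar>"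
      by (simp add: norm_mult nz)
    also have "\<dots> \<le> norm (a n) + \<bar>\<alpha> n\<bar> * (norm (a n) + \<bar>p n\<bar>) + \<bar>\<beta> n\<bar> * \<bar>p n\<bar>"
      using pS by (intro add_mono mult_left_mono) auto
    finally show ?thesis by (simp add: algebra_simps)
  qed
  have "(\<lambda>n. 1 + \<bar>\<alpha> n\<bar> + 1 / K) \<longlonglongrightarrow> 1 + \<bar>0\<bar> + 1 / K"
    by (intro tendsto_intros lim)
  moreover have "1 + \<bar>0\<bar> + 1 / K < R" unfolding K(2) using R by (simp add: field_simps)
  ultimately have e1: "eventually (\<lambda>n. 1 + \<bar>\<alpha> n\<bar> + 1 / K < R) sequentially"
    by (rule order_tendstoD)
  have "(\<lambda>n. 1 + K * (\<bar>\<alpha> n\<bar> + \<bar>\<beta> n\<bar>)) \<longlonglongrightarrow> 1 + K * (\<bar>0\<bar> + \<bar>0\<bar>)"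
    by (intro tendsto_intros lim)
  moreover have "1 + K * (\<bar>0\<bar> + \<bar>0\<bar>) < R" using R by simp
  ultimately have e2: "eventually (\<lambda>n. 1 + K * (\<bar>\<alpha> n\<bar> + \<bar>\<beta> n\<bar>) < R) sequentially"
    by (rule order_tendstoD)
  have "eventually (\<lambda>n. M (Suc n) \<le> R * M n) sequentially"
    using e1 e2
  proof eventually_elim
    case (elim n)
    have "M (Suc n) \<le> K * ((1 + \<bar>\<alpha> n\<bar>) * norm (a n) + (\<bar>\<alpha> n\<bar> + \<bar>\<beta> n\<bar>) * \<bar>p n\<bar>) + (norm (a n) + \<bar>p n\<bar>)"
      unfolding M_def using aS[of n] pS[of n] K(1) by (intro add_mono mult_left_mono) auto
    also have "\<dots> = (1 + \<bar>\<alpha> n\<bar> + 1 / K) * (K * norm (a n)) + (1 + K * (\<bar>\<alpha> n\<bar> + \<bar>\<beta> n\<bar>)) * \<bar>p n\<bar>"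
      using K(1) by (simp add: algebra_simps)
    also have "\<dots> \<le> R * (K * norm (a n)) + R * \<bar>p n\<bar>"
      using elim K(1) by (intro add_mono mult_right_mono) auto
    finally show ?case by (simp add: M_def algebra_simps)
  qed
  then obtain C where C: "C > 0" "\<And>n. M n \<le> C * R ^ n"
    using eventually_geometric_bound[of M R] R by auto
  have "\<bar>p n\<bar> \<le> M n" for n using K(1) by (simp add: M_def)
  thus ?thesis using C order_trans by blast
qed

section \<open>q-numbers and q-Hermite polynomials\<close>

lemma q_bracket_0 [simp]: "q_bracket 0 q = 0"
  by (simp add: q_bracket_def)

lemma q_bracket_1 [simp]: "q_bracket (Suc 0) q = 1"
  by (simp add: q_bracket_def)

lemma q_bracket_Suc: "q_bracket (Suc n) q = q_bracket n q + q ^ n"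
  by (simp add: q_bracket_def)

lemma q_bracket_add: "q_bracket (m + n) q = q_bracket m q + q ^ m * q_bracket n q"
  by (induction n) (simp_all add: q_bracket_def power_add algebra_simps)

text \<open>This form of the geometric sum also makes sense at \<open>q = 1\<close>, where both sides vanish.\<close>

lemma one_minus_q_bracket: "(1 - q) * q_bracket n q = 1 - q ^ n"
proof (induction n)
  case (Suc n)
  thus ?case by (simp add: q_bracket_Suc distrib_left) (simp add: algebra_simps)
qed simp

lemma q_bracket_at_1 [simp]: "q_bracket n 1 = real n"
  by (simp add: q_bracket_def)

lemma q_bracket_pos:
  assumes "-1 < q" "q \<le> 1" "n > 0"
  shows "q_bracket n q > 0"
proof (cases "q = 1")
  case False
  hence "\<bar>q\<bar> < 1" using assms by auto
  hence "\<bar>q ^ n\<bar> < 1" using assms(3) by (simp add: power_abs power_less_one_iff)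
  hence "(1 - q) * q_bracket n q > 0" by (simp add: one_minus_q_bracket)
  thus ?thesis using False assms(2) by (simp add: zero_less_mult_iff)
qed (use assms in auto)

lemma q_fact_0 [simp]: "q_fact 0 q = 1"
  by (simp add: q_fact_def)

lemma q_fact_Suc: "q_fact (Suc n) q = q_bracket (Suc n) q * q_fact n q"
  by (simp add: q_fact_def mult.commute)

lemma q_fact_at_1 [simp]: "q_fact n 1 = fact n"
  by (induction n) (simp_all add: q_fact_Suc)

lemma q_fact_pos: "-1 < q \<Longrightarrow> q \<le> 1 \<Longrightarrow> q_fact n q > 0"
  by (induction n) (simp_all add: q_fact_Suc q_bracket_pos)

lemma q_poch_Suc: "q_poch a (Suc n) q = q_poch a n q * (1 - a * q ^ n)"
  by (simp add: q_poch_def)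

lemma q_poch_0 [simp]: "q_poch a 0 q = 1"
  by (simp add: q_poch_def)

lemma q_poch_sq_pos:
  assumes "-1 < q" "q \<le> 1" "\<bar>\<rho>\<bar> < 1"
  shows "1 - \<rho>\<^sup>2 * q ^ n > 0" "q_poch (\<rho>\<^sup>2) n q > 0"
proof -
  have pos: "1 - \<rho>\<^sup>2 * q ^ n > 0" for n
  proof -
    have "\<bar>q ^ n\<bar> \<le> 1" using assms(1,2) by (auto simp: power_abs intro!: power_le_one)
    hence "\<bar>\<rho>\<^sup>2 * q ^ n\<bar> \<le> \<rho>\<^sup>2" by (simp add: abs_mult mult_left_le)
    moreover have "\<rho>\<^sup>2 < 1" using assms(3) by (simp add: abs_square_less_1)
    ultimately show ?thesis by linarith
  qed
  show "1 - \<rho>\<^sup>2 * q ^ n > 0" "q_poch (\<rho>\<^sup>2) n q > 0"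
    using pos by (auto simp: q_poch_def intro!: prod_pos)
qed

definition q_hermite :: "nat \<Rightarrow> real \<Rightarrow> real \<Rightarrow> real" where
  "q_hermite n x q = al_salam_chihara n x 0 0 q"

lemma q_hermite_0 [simp]: "q_hermite 0 x q = 1"
  by (simp add: q_hermite_def)

lemma q_hermite_Suc:
  "q_hermite (Suc n) x q = x * q_hermite n x q - q_bracket n q * q_hermite (n - 1) x q"
  by (cases n) (simp_all add: q_hermite_def)

lemma q_hermite_1 [simp]: "q_hermite (Suc 0) x q = x"
  by (simp add: q_hermite_Suc)

text \<open>Scaling by \<open>sqrt (1 - q) ^ n\<close> turns the recurrence into the one of the Chebyshev polynomials with
\<open>c = sqrt (1 - q) * x / 2\<close>, perturbed by \<open>q ^ Suc n\<close>; the condition \<open>\<bar>c\<bar> \<le> 1\<close> is membership in the support.\<close>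

lemma q_hermite_growth:
  assumes q: "\<bar>q\<bar> < 1" and x: "x \<in> q_support q" and R: "R > 1"
  shows "\<exists>C>0. \<forall>n. \<bar>q_hermite n x q\<bar> \<le> C * (R / sqrt (1 - q)) ^ n"
proof -
  define s where "s = sqrt (1 - q)"
  have s: "s > 0" "s * s = 1 - q" using q by (auto simp: s_def)
  have "\<bar>x\<bar> \<le> 2 / s" using x q by (auto simp: q_support_def s_def abs_le_iff minus_le_iff split: if_splits)
  hence c: "\<bar>s * x / 2\<bar> \<le> 1" using s by (simp add: abs_mult field_simps)
  have rec: "q_hermite (Suc (Suc n)) x q * s ^ Suc (Suc n) =
      (2 * (s * x / 2) - 0) * (q_hermite (Suc n) x q * s ^ Suc n)
      - (1 - q ^ Suc n) * (q_hermite n x q * s ^ n)" for n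
  proof -
    have "q_hermite (Suc (Suc n)) x q * s ^ Suc (Suc n) =
       s * x * (q_hermite (Suc n) x q * s ^ Suc n)
       - ((s * s) * q_bracket (Suc n) q) * (q_hermite n x q * s ^ n)"
      by (simp add: q_hermite_Suc[of "Suc n"] algebra_simps)
    thus ?thesis unfolding s(2) one_minus_q_bracket by simp
  qed
  have "(\<lambda>n. q ^ Suc n) \<longlonglongrightarrow> 0" using q by (intro LIMSEQ_Suc LIMSEQ_power_zero) auto
  then obtain C where C: "C > 0" "\<And>n. \<bar>q_hermite n x q * s ^ n\<bar> \<le> C * R ^ n"
    using perturbed_chebyshev_growth[of "\<lambda>n. q_hermite n x q * s ^ n" "s * x / 2" "\<lambda>_. 0" "\<lambda>n. q ^ Suc n" R, OF rec _ _ c R]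
    by auto
  have "\<bar>q_hermite n x q\<bar> \<le> C * (R / s) ^ n" for n
    using C(2)[of n] s(1) by (simp add: abs_mult power_divide field_simps)
  thus ?thesis using C(1) unfolding s_def by blast
qed

text \<open>After division by \<open>sqrt (fact n)\<close> the recurrence tends to \<open>w (n + 2) = - w n\<close>, a perturbed Chebyshev recurrence
at \<open>c = 0\<close> for every real \<open>x\<close>.\<close>

lemma hermite_growth:
  assumes R: "R > 1"
  shows "\<exists>C>0. \<forall>n. \<bar>q_hermite n x 1\<bar> \<le> C * R ^ n * sqrt (fact n)"
proof -
  define w where "w n = q_hermite n x 1 / sqrt (fact n)" for n
  define \<alpha> where "\<alpha> n = - x / sqrt (real (n + 2))" for n
  define \<beta> where "\<beta> n = 1 - sqrt (real (n + 1) / real (n + 2))" for n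
  have rec: "w (Suc (Suc n)) = (2 * 0 - \<alpha> n) * w (Suc n) - (1 - \<beta> n) * w n" for n
  proof -
    define F A B where "F = sqrt (fact n :: real)" and "A = sqrt (real (n + 1))" and "B = sqrt (real (n + 2))"
    have f: "sqrt (fact (Suc n)) = A * F" "sqrt (fact (Suc (Suc n))) = B * (A * F)" "sqrt (real (n + 1) / real (n + 2)) = A / B"
      by (simp_all add: F_def A_def B_def fact_Suc[of "Suc n"] fact_Suc[of n] real_sqrt_mult real_sqrt_divide
            add.commute del: fact_Suc)
    have pos: "F > 0" "A > 0" "B > 0" by (auto simp: F_def A_def B_def)
    have AA: "real (Suc n) = A * A" by (simp add: A_def)
    have "q_hermite (Suc (Suc n)) x 1 = x * q_hermite (Suc n) x 1 - A * A * q_hermite n x 1"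
      using q_hermite_Suc[of "Suc n" x 1] by (simp only: q_bracket_at_1 AA diff_Suc_1)
    thus ?thesis using pos unfolding w_def f \<alpha>_def \<beta>_def B_def[symmetric] F_def[symmetric]
      by (simp add: field_simps)
  qed
  have sqinf: "filterlim (\<lambda>n. sqrt (real (n + 2))) at_top sequentially"
    by (rule filterlim_compose[OF sqrt_at_top])
       (intro filterlim_compose[OF filterlim_real_sequentially] filterlim_add_const_nat_at_top)
  have a0: "\<alpha> \<longlonglongrightarrow> 0" unfolding \<alpha>_def
    by (rule real_tendsto_divide_at_top[OF tendsto_const sqinf])
  have "(\<lambda>n. real (n + 1) / real (n + 2)) \<longlonglongrightarrow> 1"
    using LIMSEQ_Suc[OF LIMSEQ_n_over_Suc_n] by simp
  hence "(\<lambda>n. sqrt (real (n + 1) / real (n + 2))) \<longlonglongrightarrow> sqrt 1" by (rule tendsto_real_sqrt)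
  hence "\<beta> \<longlonglongrightarrow> 1 - sqrt 1" unfolding \<beta>_def by (intro tendsto_diff tendsto_const)
  hence b0: "\<beta> \<longlonglongrightarrow> 0" by simp
  obtain C where C: "C > 0" "\<And>n. \<bar>w n\<bar> \<le> C * R ^ n"
    using perturbed_chebyshev_growth[of w 0 \<alpha> \<beta> R, OF rec a0 b0 _ R] by auto
  have "\<bar>q_hermite n x 1\<bar> \<le> C * R ^ n * sqrt (fact n)" for n
    using C(2)[of n] by (simp add: w_def field_simps)
  thus ?thesis using C(1) by blast
qed

section \<open>Two finite expansions\<close>

text \<open>Gauss's q-binomial formula in its inverse form: powers of \<open>x\<close> in the Newton basis with nodes
\<open>d, d * q, d * q\<^sup>2, \<dots>\<close>. Multiplication by \<open>x = (x - d * q ^ k) + d * q ^ k\<close> moves a basis element up by one or keeps it, and the two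
contributions to a coefficient add up by \<open>[k] + q ^ k * [a - k] = [a]\<close>.\<close>

lemma q_newton_expansion:
  assumes q: "-1 < q" "q \<le> 1"
  shows "x ^ a / q_fact a q =
    (\<Sum>k\<le>a. q_poch_hom x d k q / q_fact k q * (d ^ (a - k) / q_fact (a - k) q))"
proof (induction a)
  case 0
  show ?case by (simp add: q_poch_hom_def)
next
  case (Suc a)
  define f where "f m k = q_poch_hom x d k q / q_fact k q * (d ^ (m - k) / q_fact (m - k) q)" for m k
  have nz: "q_fact n q \<noteq> 0" "q_bracket (Suc n) q \<noteq> 0" for n
    using q_fact_pos[OF q, of n] q_bracket_pos[OF q, of "Suc n"] by auto
  have step: "x * f a k = q_bracket (Suc k) q * f (Suc a) (Suc k) + q ^ k * q_bracket (Suc a - k) q * f (Suc a) k"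
    if "k \<le> a" for k
  proof -
    have *: "Suc a - k = Suc (a - k)" using that by simp
    have p: "q_poch_hom x d (Suc k) q = q_poch_hom x d k q * (x - d * q ^ k)"
      by (simp add: q_poch_hom_def)
    show ?thesis unfolding f_def * p q_fact_Suc
      using nz by (simp add: field_simps)
  qed
  have "x * (\<Sum>k\<le>a. f a k) = (\<Sum>k\<le>a. q_bracket (Suc k) q * f (Suc a) (Suc k))
      + (\<Sum>k\<le>a. q ^ k * q_bracket (Suc a - k) q * f (Suc a) k)"
    unfolding sum_distrib_left by (simp add: step sum.distrib)
  also have "(\<Sum>k\<le>a. q_bracket (Suc k) q * f (Suc a) (Suc k)) = (\<Sum>k\<le>Suc a. q_bracket k q * f (Suc a) k)"
    by (subst sum.atMost_Suc_shift) simp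
  also have "(\<Sum>k\<le>a. q ^ k * q_bracket (Suc a - k) q * f (Suc a) k)
     = (\<Sum>k\<le>Suc a. q ^ k * q_bracket (Suc a - k) q * f (Suc a) k)" by simp
  also have "(\<Sum>k\<le>Suc a. q_bracket k q * f (Suc a) k) + \<dots> = (\<Sum>k\<le>Suc a. q_bracket (Suc a) q * f (Suc a) k)"
    unfolding sum.distrib[symmetric]
  proof (rule sum.cong)
    fix k assume "k \<in> {..Suc a}"
    hence "q_bracket (Suc a) q = q_bracket k q + q ^ k * q_bracket (Suc a - k) q"
      using q_bracket_add[of k "Suc a - k" q] by simp
    thus "q_bracket k q * f (Suc a) k + q ^ k * q_bracket (Suc a - k) q * f (Suc a) k = q_bracket (Suc a) q * f (Suc a) k"
      by (simp add: algebra_simps)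
  qed simp
  also have "\<dots> = q_bracket (Suc a) q * (\<Sum>k\<le>Suc a. f (Suc a) k)" by (rule sum_distrib_left[symmetric])
  finally have "x * (x ^ a / q_fact a q) = q_bracket (Suc a) q * (\<Sum>k\<le>Suc a. f (Suc a) k)"
    using Suc.IH by (simp add: f_def)
  thus ?case using nz unfolding f_def q_fact_Suc by (simp add: field_simps)
qed

text \<open>Rogers' linearization formula. For fixed \<open>n\<close> the right-hand side satisfies the recurrence of the q-Hermite
polynomials in \<open>m\<close>. Comparing coefficients of a single \<open>H\<close> reduces this to two instances of the addition rule for
q-numbers, once for \<open>[m + 1]\<close> and once for \<open>[(m - j) + (n - j)]\<close>. Summing over \<open>j \<le> n\<close> with coefficients
that vanish for \<open>j > m\<close> keeps the index set the same throughout the induction.\<close>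

lemma q_hermite_linearization:
  assumes q: "-1 < q" "q \<le> 1"
  shows "q_hermite m x q * q_hermite n x q / (q_fact m q * q_fact n q) =
    (\<Sum>j\<le>min m n. q_hermite ((m - j) + (n - j)) x q / (q_fact j q * q_fact (m - j) q * q_fact (n - j) q))"
proof -
  define H where "H k = q_hermite k x q" for k
  define e where "e m j = (if j \<le> m then 1 / q_fact (m - j) q else 0)" for m j
  define c where "c j = 1 / (q_fact j q * q_fact (n - j) q)" for j
  define S where "S m = (\<Sum>j\<le>n. e m j * c j * H (m + n - 2 * j))" for m
  have nz: "q_fact k q \<noteq> 0" "q_bracket (Suc k) q \<noteq> 0" for k
    using q_fact_pos[OF q, of k] q_bracket_pos[OF q, of "Suc k"] by auto
  have HS: "x * H k = H (Suc k) + q_bracket k q * H (k - 1)" for k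
    using q_hermite_Suc[of k x q] by (simp add: H_def)
  have e_step: "q_bracket (Suc m - j) q * e (Suc m) j = e m j" for m j
    using nz by (auto simp: e_def Suc_diff_le q_fact_Suc le_Suc_eq)
  have e_shift: "e (Suc m) (Suc j) = e m j" for m j by (simp add: e_def)
  have rec: "q_bracket (Suc m) q * S (Suc m) = x * S m - (\<Sum>j\<le>n. q_bracket (m - j) q * e m j * c j * H (m + n - 1 - 2 * j))" for m
  proof -
    define D where "D j = q ^ (Suc m - j) * q_bracket j q * e (Suc m) j * c j * H (Suc m + n - 2 * j)" for j
    \<comment> \<open>Splitting \<open>[m + 1]\<close> separates the coefficient inherited from \<open>m\<close> from a remainder \<open>D j\<close>.\<close>
    have t1: "q_bracket (Suc m) q * (e (Suc m) j * c j * H (Suc m + n - 2 * j)) =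
        e m j * c j * H (Suc m + n - 2 * j) + D j" for j
    proof (cases "j \<le> Suc m")
      case True
      have "q_bracket (Suc m) q = q_bracket (Suc m - j) q + q ^ (Suc m - j) * q_bracket j q"
        using q_bracket_add[of "Suc m - j" j q] True by simp
      thus ?thesis unfolding e_step[of m j, symmetric] D_def by (simp add: algebra_simps)
    qed (simp add: e_def D_def)
    have t2: "x * (e m j * c j * H (m + n - 2 * j)) =
        e m j * c j * H (Suc m + n - 2 * j) + e m j * c j * q_bracket (m + n - 2 * j) q * H (m + n - 1 - 2 * j)"
      if "j \<le> n" for j
    proof (cases "j \<le> m")
      case True
      have *: "Suc m + n - 2 * j = Suc (m + n - 2 * j)" "m + n - 2 * j - 1 = m + n - 1 - 2 * j"
        using True that by auto
      have "x * (e m j * c j * H (m + n - 2 * j)) = e m j * c j * (x * H (m + n - 2 * j))" by (simp only: mult_ac)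
      thus ?thesis unfolding HS * by (simp only: distrib_left mult.assoc)
    qed (simp add: e_def)
    \<comment> \<open>The lowering part of \<open>x * H\<close>, reduced by the subtracted sum, is the remainder \<open>D\<close> at the next index.\<close>
    have t3: "e m j * c j * q_bracket (m + n - 2 * j) q * H (m + n - 1 - 2 * j)
        - q_bracket (m - j) q * e m j * c j * H (m + n - 1 - 2 * j) =
        (if j = n then 0 else D (Suc j))" if "j \<le> n" for j
    proof (cases "j \<le> m")
      case True
      have "m + n - 2 * j = (m - j) + (n - j)" using True that by simp
      hence 1: "q_bracket (m + n - 2 * j) q = q_bracket (m - j) q + q ^ (m - j) * q_bracket (n - j) q"
        by (simp only: q_bracket_add)
      have 2: "q_bracket (n - j) q * c j = q_bracket (Suc j) q * c (Suc j)" if "j \<noteq> n"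
      proof -
        have "n - j = Suc (n - Suc j)" using \<open>j \<le> n\<close> that by simp
        thus ?thesis unfolding c_def using nz by (simp add: q_fact_Suc)
      qed
      have 3: "D (Suc j) = q ^ (m - j) * (q_bracket (Suc j) q * c (Suc j)) * e m j * H (m + n - 1 - 2 * j)"
        unfolding D_def e_shift using True by simp
      show ?thesis
      proof (cases "j = n")
        case True
        thus ?thesis unfolding 1 by simp
      next
        case False
        show ?thesis unfolding 1 3 2[OF False, symmetric] using False by (simp add: algebra_simps)
      qed
    qed (auto simp: e_def D_def)
    have D: "(\<Sum>j\<le>n. D j) = (\<Sum>j\<le>n. if j = n then 0 else D (Suc j))"
    proof (cases n)
      case (Suc n')
      have "(\<Sum>j\<le>n. D j) = D 0 + (\<Sum>j\<le>n'. D (Suc j))" unfolding Suc by (rule sum.atMost_Suc_shift)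
      thus ?thesis unfolding Suc by (simp add: D_def)
    qed (simp add: D_def)
    have "q_bracket (Suc m) q * S (Suc m) = (\<Sum>j\<le>n. e m j * c j * H (Suc m + n - 2 * j)) + (\<Sum>j\<le>n. D j)"
      unfolding S_def sum_distrib_left t1 by (rule sum.distrib)
    also have "(\<Sum>j\<le>n. D j) = (\<Sum>j\<le>n. e m j * c j * q_bracket (m + n - 2 * j) q * H (m + n - 1 - 2 * j))
        - (\<Sum>j\<le>n. q_bracket (m - j) q * e m j * c j * H (m + n - 1 - 2 * j))"
      unfolding D sum_subtractf[symmetric] by (rule sum.cong) (use t3 in auto)
    also have "(\<Sum>j\<le>n. e m j * c j * H (Suc m + n - 2 * j)) + \<dots> = x * S m - (\<Sum>j\<le>n. q_bracket (m - j) q * e m j * c j * H (m + n - 1 - 2 * j))"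
      unfolding S_def sum_distrib_left by (simp add: t2 sum.distrib)
    finally show ?thesis .
  qed
  have "H m * H n / (q_fact m q * q_fact n q) = S m \<and> H (Suc m) * H n / (q_fact (Suc m) q * q_fact n q) = S (Suc m)" for m
  proof (induction m)
    case 0
    have "S 0 = (\<Sum>j\<le>n. if j = 0 then H n / q_fact n q else 0)"
      unfolding S_def by (rule sum.cong) (auto simp: e_def c_def)
    hence 1: "S 0 = H n / q_fact n q" by simp
    have "q_bracket (Suc 0) q * S (Suc 0) = x * S 0" unfolding rec by simp
    thus ?case by (simp add: 1 H_def q_fact_Suc)
  next
    case (Suc m)
    have pr: "(\<Sum>j\<le>n. q_bracket (Suc m - j) q * e (Suc m) j * c j * H (Suc m + n - 1 - 2 * j)) = S m"
      unfolding S_def e_step by simp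
    have "q_bracket (Suc (Suc m)) q * S (Suc (Suc m)) = x * S (Suc m) - S m" unfolding rec pr ..
    also have "\<dots> = (x * H (Suc m) - q_bracket (Suc m) q * H m) * H n / (q_fact (Suc m) q * q_fact n q)"
      using Suc nz by (simp add: q_fact_Suc field_simps)
    also have "x * H (Suc m) - q_bracket (Suc m) q * H m = H (Suc (Suc m))" using HS[of "Suc m"] by simp
    finally show ?case using Suc nz by (simp add: q_fact_Suc[of "Suc m"] field_simps)
  qed
  hence "H m * H n / (q_fact m q * q_fact n q) = S m" ..
  also have "S m = (\<Sum>j\<le>min m n. e m j * c j * H (m + n - 2 * j))"
    unfolding S_def by (rule sum.mono_neutral_right) (auto simp: e_def)
  also have "\<dots> = (\<Sum>j\<le>min m n. H ((m - j) + (n - j)) / (q_fact j q * q_fact (m - j) q * q_fact (n - j) q))"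
  proof (rule sum.cong)
    fix j assume "j \<in> {..min m n}"
    hence "j \<le> m" and 1: "m + n - 2 * j = (m - j) + (n - j)" by auto
    thus "e m j * c j * H (m + n - 2 * j) = H ((m - j) + (n - j)) / (q_fact j q * q_fact (m - j) q * q_fact (n - j) q)"
      unfolding 1 by (simp add: e_def c_def)
  qed simp
  finally show ?thesis unfolding H_def .
qed

section \<open>Shifted Mehler sums\<close>

definition mehler_term :: "nat \<Rightarrow> real \<Rightarrow> real \<Rightarrow> real \<Rightarrow> real \<Rightarrow> nat \<Rightarrow> real" where
  "mehler_term k \<rho> x y q n = \<rho> ^ n / q_fact n q * q_hermite (n + k) x q * q_hermite n y q"

definition mehler_sum :: "nat \<Rightarrow> real \<Rightarrow> real \<Rightarrow> real \<Rightarrow> real \<Rightarrow> real" where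
  "mehler_sum k \<rho> x y q = (\<Sum>n. mehler_term k \<rho> x y q n)"

text \<open>The relations below hold wherever all the series converge, for \<open>q < 1\<close> as well as for \<open>q = 1\<close>; convergence is
proved separately in the two cases because different growth bounds apply.\<close>

locale mehler_convergent =
  fixes \<rho> x y q :: real
  assumes q_gt: "-1 < q" and q_le: "q \<le> 1"
    and summable_mehler_term: "\<And>k. summable (mehler_term k \<rho> x y q)"
begin

abbreviation G :: "nat \<Rightarrow> real" where "G k \<equiv> mehler_sum k \<rho> x y q"

lemma G_sums: "mehler_term k \<rho> x y q sums G k"
  unfolding mehler_sum_def by (rule summable_sums[OF summable_mehler_term])

lemma q_nz: "q_fact k q \<noteq> 0" "q_bracket (Suc k) q \<noteq> 0"
  using q_fact_pos[OF q_gt q_le, of k] q_bracket_pos[OF q_gt q_le, of "Suc k"] by auto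

text \<open>The three-term recurrence in \<open>y\<close>: its second summand contains \<open>[n] / [n]! = 1 / [n - 1]!\<close>, so that shifting the
summation index by one raises the shift in \<open>x\<close>.\<close>

lemma shifted_term_sums:
  "(\<lambda>n. \<rho> ^ n / q_fact n q * q_hermite (n + k) x q * q_hermite (Suc n) y q) sums (y * G k - \<rho> * G (Suc k))"
proof -
  define f where "f n = \<rho> ^ n / q_fact n q * q_hermite (n + k) x q * (q_bracket n q * q_hermite (n - 1) y q)" for n
  have "f (Suc n) = \<rho> * mehler_term (Suc k) \<rho> x y q n" for n
    using q_nz by (simp add: f_def mehler_term_def q_fact_Suc)
  hence "(\<lambda>n. f (Suc n)) sums (\<rho> * G (Suc k))" by (simp add: sums_mult G_sums)
  hence "f sums (\<rho> * G (Suc k) + f 0)" by (simp only: sums_Suc_iff diff_add_cancel add_diff_cancel)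
  hence "f sums (\<rho> * G (Suc k))" by (simp add: f_def)
  from sums_diff[OF sums_mult[OF G_sums] this] show ?thesis
    by (rule back_subst[of "\<lambda>g. g sums _"]) (auto simp: mehler_term_def f_def q_hermite_Suc algebra_simps)
qed

text \<open>The three-term recurrence in \<open>x\<close>, with \<open>[n + k] = [k] + q ^ k * [n]\<close>. The part with \<open>[n]\<close> is again a series
with a shifted index in \<open>y\<close>; evaluating it reproduces \<open>G (Suc k)\<close> with the factor \<open>\<rho>\<^sup>2 * q ^ k\<close>, which moves
to the left-hand side. At \<open>k = 0\<close> the last summand vanishes because \<open>[0] = 0\<close>.\<close>

lemma mehler_sum_recurrence:
  "(1 - \<rho>\<^sup>2 * q ^ k) * G (Suc k) = (x - \<rho> * y * q ^ k) * G k - q_bracket k q * G (k - 1)"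
proof -
  define f where "f n = q_bracket n q * (\<rho> ^ n / q_fact n q) * q_hermite (n + k - 1) x q * q_hermite n y q" for n
  have "f (Suc n) = \<rho> * (\<rho> ^ n / q_fact n q * q_hermite (n + k) x q * q_hermite (Suc n) y q)" for n
    using q_nz by (simp add: f_def q_fact_Suc)
  hence "(\<lambda>n. f (Suc n)) sums (\<rho> * (y * G k - \<rho> * G (Suc k)))"
    using sums_mult[OF shifted_term_sums] by simp
  hence "f sums (\<rho> * (y * G k - \<rho> * G (Suc k)) + f 0)" by (simp only: sums_Suc_iff diff_add_cancel add_diff_cancel)
  hence "f sums (\<rho> * (y * G k - \<rho> * G (Suc k)))" by (simp add: f_def)
  from sums_diff[OF sums_diff[OF sums_mult[OF G_sums, of x k] sums_mult[OF G_sums, of "q_bracket k q" "k - 1"]] sums_mult[OF this, of "q ^ k"]]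
  have "(\<lambda>n. x * mehler_term k \<rho> x y q n - q_bracket k q * mehler_term (k - 1) \<rho> x y q n - q ^ k * f n)
     sums (x * G k - q_bracket k q * G (k - 1) - q ^ k * (\<rho> * (y * G k - \<rho> * G (Suc k))))" .
  moreover have "x * mehler_term k \<rho> x y q n - q_bracket k q * mehler_term (k - 1) \<rho> x y q n - q ^ k * f n = mehler_term (Suc k) \<rho> x y q n" for n
  proof -
    have 1: "q_bracket k q * q_hermite (n + (k - 1)) x q = q_bracket k q * q_hermite (n + k - 1) x q"
      by (cases k) auto
    have 2: "q_bracket (n + k) q = q_bracket k q + q ^ k * q_bracket n q"
      using q_bracket_add[of k n q] by (simp add: add.commute)
    have "q_hermite (n + Suc k) x q = x * q_hermite (n + k) x q - q_bracket k q * q_hermite (n + (k - 1)) x q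
        - q ^ k * q_bracket n q * q_hermite (n + k - 1) x q"
      unfolding 1 using q_hermite_Suc[of "n + k" x q] by (simp only: 2 add_Suc_right distrib_right)
    hence "mehler_term (Suc k) \<rho> x y q n = \<rho> ^ n / q_fact n q * (x * q_hermite (n + k) x q
        - q_bracket k q * q_hermite (n + (k - 1)) x q - q ^ k * q_bracket n q * q_hermite (n + k - 1) x q) * q_hermite n y q"
      by (simp only: mehler_term_def)
    thus ?thesis unfolding mehler_term_def f_def by (simp only: algebra_simps)
  qed
  ultimately have "mehler_term (Suc k) \<rho> x y q sums (x * G k - q_bracket k q * G (k - 1) - q ^ k * (\<rho> * (y * G k - \<rho> * G (Suc k))))"
    by simp
  hence "G (Suc k) = x * G k - q_bracket k q * G (k - 1) - q ^ k * (\<rho> * (y * G k - \<rho> * G (Suc k)))"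
    using G_sums sums_unique2 by blast
  thus ?thesis by (simp add: algebra_simps power2_eq_square)
qed

text \<open>After multiplication by \<open>(\<rho>\<^sup>2)\<^sub>k\<close> the recurrence of the Mehler sums becomes that of the Al-Salam--Chihara
polynomials, and the quotient is normalized by its value at \<open>k = 0\<close>.\<close>

lemma al_salam_chihara_mehler_sum:
  "al_salam_chihara k x y \<rho> q * G 0 = q_poch (\<rho>\<^sup>2) k q * G k"
proof -
  have "al_salam_chihara k x y \<rho> q * G 0 = q_poch (\<rho>\<^sup>2) k q * G k \<and>
        al_salam_chihara (Suc k) x y \<rho> q * G 0 = q_poch (\<rho>\<^sup>2) (Suc k) q * G (Suc k)"
  proof (induction k)
    case 0
    show ?case using mehler_sum_recurrence[of 0] by (simp add: q_poch_Suc)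
  next
    case (Suc k)
    have "al_salam_chihara (Suc (Suc k)) x y \<rho> q * G 0 =
       (x - \<rho> * y * q ^ Suc k) * (al_salam_chihara (Suc k) x y \<rho> q * G 0)
       - (1 - \<rho>\<^sup>2 * q ^ k) * q_bracket (Suc k) q * (al_salam_chihara k x y \<rho> q * G 0)"
      by (simp add: algebra_simps)
    also have "\<dots> = q_poch (\<rho>\<^sup>2) (Suc k) q * ((x - \<rho> * y * q ^ Suc k) * G (Suc k) - q_bracket (Suc k) q * G k)"
      unfolding conjunct1[OF Suc.IH] conjunct2[OF Suc.IH] by (simp add: q_poch_Suc algebra_simps)
    also have "\<dots> = q_poch (\<rho>\<^sup>2) (Suc (Suc k)) q * G (Suc (Suc k))"
      using mehler_sum_recurrence[of "Suc k"] by (simp add: q_poch_Suc[of _ "Suc k"])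
    finally show ?case using Suc.IH by blast
  qed
  thus ?thesis ..
qed

text \<open>Replacing \<open>\<rho>\<close> by \<open>q * \<rho>\<close> multiplies the \<open>n\<close>-th term by \<open>q ^ n = 1 - (1 - q) * [n]\<close>: a q-derivative, which
shifts the index.\<close>

lemma mehler_sum_q_shift:
  "mehler_sum 0 (q * \<rho>) x y q = G 0 - (1 - q) * \<rho> * (y * G 1 - \<rho> * G 2)"
proof -
  define f where "f n = q_bracket n q * mehler_term 0 \<rho> x y q n" for n
  have "f (Suc n) = \<rho> * (\<rho> ^ n / q_fact n q * q_hermite (n + 1) x q * q_hermite (Suc n) y q)" for n
    using q_nz by (simp add: f_def mehler_term_def q_fact_Suc)
  hence "(\<lambda>n. f (Suc n)) sums (\<rho> * (y * G 1 - \<rho> * G 2))"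
    using sums_mult[OF shifted_term_sums[of 1]] by (simp add: numeral_2_eq_2)
  hence "f sums (\<rho> * (y * G 1 - \<rho> * G 2) + f 0)" by (simp only: sums_Suc_iff diff_add_cancel add_diff_cancel)
  hence "f sums (\<rho> * (y * G 1 - \<rho> * G 2))" by (simp add: f_def)
  from sums_diff[OF G_sums[of 0] sums_mult[OF this, of "1 - q"]]
  have "(\<lambda>n. mehler_term 0 \<rho> x y q n - (1 - q) * f n) sums (G 0 - (1 - q) * (\<rho> * (y * G 1 - \<rho> * G 2)))" .
  moreover have "mehler_term 0 \<rho> x y q n - (1 - q) * f n = mehler_term 0 (q * \<rho>) x y q n" for n
  proof -
    have "mehler_term 0 \<rho> x y q n - (1 - q) * f n = (1 - (1 - q) * q_bracket n q) * mehler_term 0 \<rho> x y q n"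
      by (simp add: f_def algebra_simps)
    thus ?thesis by (simp add: one_minus_q_bracket mehler_term_def power_mult_distrib)
  qed
  ultimately show ?thesis unfolding mehler_sum_def[of 0 "q * \<rho>"] using sums_unique by fastforce
qed

end

section \<open>The q-Mehler formula\<close>

text \<open>The reciprocal q-factorial is a product of factors tending to \<open>1 - q\<close>. This rate cancels the two factors
\<open>1 / sqrt (1 - q)\<close> in the growth of a pair of q-Hermite polynomials.\<close>

lemma inverse_q_fact_growth:
  assumes q: "\<bar>q\<bar> < 1" and R: "R > 1"
  shows "\<exists>C>0. \<forall>n. 1 / q_fact n q \<le> C * (R * (1 - q)) ^ n"
proof -
  have qq: "-1 < q" "q \<le> 1" "1 - q > 0" using q by auto
  have b: "q_bracket n q = (1 - q ^ n) / (1 - q)" for n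
    using one_minus_q_bracket[of q n] qq by (simp add: field_simps)
  have "(\<lambda>i. q ^ Suc i) \<longlonglongrightarrow> 0" using q by (intro LIMSEQ_Suc LIMSEQ_power_zero) auto
  hence "(\<lambda>i. 1 / ((1 - q ^ Suc i) / (1 - q))) \<longlonglongrightarrow> 1 / ((1 - 0) / (1 - q))"
    using qq by (intro tendsto_intros) auto
  hence lim: "(\<lambda>i. 1 / q_bracket (Suc i) q) \<longlonglongrightarrow> 1 - q" by (simp add: b)
  have "\<bar>1 - q\<bar> < R * (1 - q)" using R qq by simp
  from prod_le_geometric[OF lim this] obtain C where
    C: "C > 0" "\<And>n. \<bar>\<Prod>i<n. 1 / q_bracket (Suc i) q\<bar> \<le> C * (R * (1 - q)) ^ n" by blast
  have "(\<Prod>i<n. 1 / q_bracket (Suc i) q) = 1 / q_fact n q" for n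
    by (induction n) (simp_all add: q_fact_Suc)
  thus ?thesis using C by (metis abs_le_D1)
qed

lemma q_poch_hom_growth:
  assumes "\<bar>q\<bar> < 1" "\<bar>c\<bar> < r"
  shows "\<exists>C>0. \<forall>n. \<bar>q_poch_hom c a n q\<bar> \<le> C * r ^ n"
proof -
  have "(\<lambda>i. c - a * q ^ i) \<longlonglongrightarrow> c - a * 0"
    using assms(1) by (intro tendsto_intros LIMSEQ_power_zero) auto
  thus ?thesis unfolding q_poch_hom_def using assms(2) by (intro prod_le_geometric) auto
qed

text \<open>Each summation index below meets two Hermite polynomials and one factorial, so that the excess \<open>R\<close> of their
growth bounds occurs with exponent 3.\<close>

lemma exists_growth_margin:
  fixes r :: real
  assumes "r < 1"
  shows "\<exists>R>1. r * R ^ 3 < 1"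
proof -
  have "((\<lambda>R. r * R ^ 3) \<longlongrightarrow> r * 1 ^ 3) (at_right 1)" by (intro tendsto_intros)
  hence "eventually (\<lambda>R. r * R ^ 3 < 1) (at_right 1)" using assms by (intro order_tendstoD) auto
  hence "eventually (\<lambda>R. R > 1 \<and> r * R ^ 3 < 1) (at_right 1)"
    by (intro eventually_conj eventually_at_right_less)
  thus ?thesis using eventually_happens[of _ "at_right (1::real)"] by fastforce
qed

lemma mehler_term_abs_summable:
  assumes q: "\<bar>q\<bar> < 1" and \<rho>: "\<bar>\<rho>\<bar> < 1" and xy: "x \<in> q_support q" "y \<in> q_support q"
  shows "summable (\<lambda>n. norm (mehler_term k \<rho> x y q n))"
proof -
  obtain R where R: "R > 1" "\<bar>\<rho>\<bar> * R ^ 3 < 1" using exists_growth_margin[OF \<rho>] by blast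
  define s where "s = sqrt (1 - q)"
  have s: "s > 0" "1 - q = s * s" using q by (auto simp: s_def)
  obtain A where A: "A > 0" "\<And>n. \<bar>q_hermite n x q\<bar> \<le> A * (R / s) ^ n"
    using q_hermite_growth[OF q xy(1) R(1)] unfolding s_def by blast
  obtain B where B: "B > 0" "\<And>n. \<bar>q_hermite n y q\<bar> \<le> B * (R / s) ^ n"
    using q_hermite_growth[OF q xy(2) R(1)] unfolding s_def by blast
  obtain C where C: "C > 0" "\<And>n. 1 / q_fact n q \<le> C * (R * (s * s)) ^ n"
    using inverse_q_fact_growth[OF q R(1)] unfolding s(2) by blast
  have bd: "norm (mehler_term k \<rho> x y q n) \<le> A * B * C * (R / s) ^ k * (\<bar>\<rho>\<bar> * R ^ 3) ^ n" for n
  proof -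
    have pos: "q_fact n q > 0" using q by (intro q_fact_pos) auto
    have "norm (mehler_term k \<rho> x y q n) = \<bar>\<rho>\<bar> ^ n * (1 / q_fact n q) * \<bar>q_hermite (n + k) x q\<bar> * \<bar>q_hermite n y q\<bar>"
      using pos by (simp add: mehler_term_def abs_mult power_abs)
    also have "\<dots> \<le> \<bar>\<rho>\<bar> ^ n * (C * (R * (s * s)) ^ n) * (A * (R / s) ^ (n + k)) * (B * (R / s) ^ n)"
      using A B C R s(1) pos by (intro mult_mono) auto
    also have "\<dots> = A * B * C * (R / s) ^ k * (\<bar>\<rho>\<bar> * (R * (s * s)) * (R / s) * (R / s)) ^ n"
      by (simp only: power_add power_mult_distrib mult_ac)
    also have "\<bar>\<rho>\<bar> * (R * (s * s)) * (R / s) * (R / s) = \<bar>\<rho>\<bar> * R ^ 3"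
      using s(1) by (simp add: field_simps power3_eq_cube)
    finally show ?thesis .
  qed
  have "summable (\<lambda>n. A * B * C * (R / s) ^ k * (\<bar>\<rho>\<bar> * R ^ 3) ^ n)"
    using R by (intro summable_mult summable_geometric) auto
  thus ?thesis by (rule summable_comparison_test'[where N = 0]) (use bd in auto)
qed

lemma mehler_convergent_less_1:
  assumes "\<bar>q\<bar> < 1" "\<bar>\<rho>\<bar> < 1" "x \<in> q_support q" "y \<in> q_support q"
  shows "mehler_convergent \<rho> x y q"
  using assms by unfold_locales (auto intro: summable_norm_cancel mehler_term_abs_summable)

text \<open>With \<open>X = sqrt (1 - q) * x / 2 = cos \<phi>\<close> and \<open>Y = sqrt (1 - q) * y / 2 = cos \<psi>\<close>, the polynomial \<open>v0\<close> is the product of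
\<open>1 + \<rho>\<^sup>2 - 2 * \<rho> * cos (\<phi> + \<psi>)\<close> and \<open>1 + \<rho>\<^sup>2 - 2 * \<rho> * cos (\<phi> - \<psi>)\<close>; here \<open>C\<close> and \<open>S\<close> stand for the products
of the cosines and, up to sign, of the sines. Each factor is at least \<open>(1 - \<bar>\<rho>\<bar>)\<^sup>2\<close>.\<close>

lemma v0_pos:
  assumes q: "\<bar>q\<bar> < 1" and \<rho>: "\<bar>\<rho>\<bar> < 1" and xy: "x \<in> q_support q" "y \<in> q_support q"
  shows "v0 x y \<rho> q > 0"
proof -
  define s where "s = sqrt (1 - q)"
  have s: "s > 0" "1 - q = s\<^sup>2" using q by (auto simp: s_def)
  define X Y where "X = s * x / 2" and "Y = s * y / 2"
  have "\<bar>x\<bar> \<le> 2 / s" "\<bar>y\<bar> \<le> 2 / s"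
    using xy q by (auto simp: q_support_def s_def abs_le_iff minus_le_iff split: if_splits)
  hence "\<bar>X\<bar> \<le> 1" "\<bar>Y\<bar> \<le> 1" using s by (simp_all add: X_def Y_def abs_mult field_simps)
  hence XY: "X\<^sup>2 \<le> 1" "Y\<^sup>2 \<le> 1" by (simp_all add: abs_square_le_1)
  define C S where "C = X * Y" and "S = sqrt ((1 - X\<^sup>2) * (1 - Y\<^sup>2))"
  have S2: "S\<^sup>2 = (1 - X\<^sup>2) * (1 - Y\<^sup>2)" using XY by (simp add: S_def)
  have cs: "\<bar>C + t * S\<bar> \<le> 1" if "t\<^sup>2 = 1" for t
  proof -
    have e: "(X\<^sup>2 - Y\<^sup>2)\<^sup>2 + (2 * X * Y) ^ 2 = (X\<^sup>2 + Y\<^sup>2)\<^sup>2" by (simp add: power2_eq_square algebra_simps)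
    have t1: "\<bar>t\<bar> = 1" using that by (metis abs_1 power2_eq_iff abs_minus_cancel power_one)
    have c1: "\<bar>C\<bar> \<le> (X\<^sup>2 + Y\<^sup>2) / 2"
    proof -
      have "(\<bar>X\<bar> - \<bar>Y\<bar>)\<^sup>2 \<ge> 0" by simp
      thus ?thesis by (simp add: C_def abs_mult power2_eq_square algebra_simps)
    qed
    have s1: "S \<le> ((1 - X\<^sup>2) + (1 - Y\<^sup>2)) / 2"
      unfolding S_def using XY by (intro arith_geo_mean_sqrt) auto
    have s0: "S \<ge> 0" unfolding S_def using XY by (intro real_sqrt_ge_zero mult_nonneg_nonneg) auto
    have "\<bar>C + t * S\<bar> \<le> \<bar>C\<bar> + \<bar>t\<bar> * S" using s0 by (metis abs_mult abs_of_nonneg abs_triangle_ineq)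
    thus ?thesis using c1 s1 t1 by simp
  qed
  have pos: "1 + \<rho>\<^sup>2 - 2 * \<rho> * c > 0" if "\<bar>c\<bar> \<le> 1" for c
  proof -
    have "\<bar>\<rho> * c\<bar> \<le> \<bar>\<rho>\<bar>" using that by (simp add: abs_mult mult_left_le)
    moreover have "(1 - \<bar>\<rho>\<bar>)\<^sup>2 > 0" using \<rho> by simp
    moreover have "(1 - \<bar>\<rho>\<bar>)\<^sup>2 = 1 + \<rho>\<^sup>2 - 2 * \<bar>\<rho>\<bar>" by (simp add: power2_eq_square algebra_simps)
    ultimately show ?thesis by linarith
  qed
  have "v0 x y \<rho> q = (1 - \<rho>\<^sup>2)\<^sup>2 - 4 * \<rho> * (1 + \<rho>\<^sup>2) * (X * Y) + 4 * \<rho>\<^sup>2 * (X\<^sup>2 + Y\<^sup>2)"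
    unfolding v0_def s(2) X_def Y_def by (simp add: power2_eq_square algebra_simps)
  also have "\<dots> = (1 + \<rho>\<^sup>2 - 2 * \<rho> * C)\<^sup>2 - 4 * \<rho>\<^sup>2 * ((1 - X\<^sup>2) * (1 - Y\<^sup>2))"
    unfolding C_def by (simp add: power2_eq_square algebra_simps)
  also have "\<dots> = (1 + \<rho>\<^sup>2 - 2 * \<rho> * (C + 1 * S)) * (1 + \<rho>\<^sup>2 - 2 * \<rho> * (C + (-1) * S))"
    unfolding S2[symmetric] by (simp add: power2_eq_square algebra_simps)
  also have "\<dots> > 0" by (intro mult_pos_pos pos cs) auto
  finally show ?thesis .
qed

lemma convergent_prod_geometric:
  fixes f :: "nat \<Rightarrow> real"
  assumes "\<bar>q\<bar> < 1" "\<And>k. \<bar>f k - 1\<bar> \<le> C * \<bar>q\<bar> ^ k"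
  shows "convergent_prod f"
proof -
  have "summable (\<lambda>k. C * \<bar>q\<bar> ^ k)" using assms(1) by (intro summable_mult summable_geometric) auto
  hence "summable (\<lambda>k. norm (f k - 1))"
    by (rule summable_comparison_test'[where N = 0]) (use assms(2) in auto)
  thus ?thesis by (intro abs_convergent_prod_imp_convergent_prod summable_imp_abs_convergent_prod)
qed

lemma convergent_prod_v0:
  assumes q: "\<bar>q\<bar> < 1" and \<rho>: "\<bar>\<rho>\<bar> < 1"
  shows "convergent_prod (\<lambda>k. v0 x y (\<rho> * q ^ k) q)"
proof (rule convergent_prod_geometric[OF q])
  fix k
  define t where "t = \<rho> * q ^ k"
  define D where "D = 3 + 2 * \<bar>(1 - q) * x * y\<bar> + \<bar>(1 - q) * (x\<^sup>2 + y\<^sup>2)\<bar>"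
  have qk: "\<bar>q\<bar> ^ k \<le> 1" using q by (simp add: power_le_one)
  have t: "\<bar>t\<bar> \<le> \<bar>q\<bar> ^ k" using \<rho> by (simp add: t_def abs_mult power_abs mult_left_le_one_le)
  hence t1: "\<bar>t\<bar> \<le> 1" using qk by linarith
  hence t2: "t\<^sup>2 \<le> 1" by (simp add: abs_square_le_1)
  have "v0 x y t q - 1 = t * (- 2 * t + t * t\<^sup>2 - (1 + t\<^sup>2) * ((1 - q) * x * y) + t * ((1 - q) * (x\<^sup>2 + y\<^sup>2)))"
    by (simp add: v0_def power2_eq_square algebra_simps)
  hence "\<bar>v0 x y t q - 1\<bar> = \<bar>t\<bar> * \<bar>- 2 * t + t * t\<^sup>2 - (1 + t\<^sup>2) * ((1 - q) * x * y) + t * ((1 - q) * (x\<^sup>2 + y\<^sup>2))\<bar>"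
    by (simp only: abs_mult)
  also have "\<dots> \<le> \<bar>q\<bar> ^ k * D"
  proof (intro mult_mono t)
    have "\<bar>t * t\<^sup>2\<bar> \<le> 1 * 1" unfolding abs_mult using t1 t2 by (intro mult_mono) auto
    moreover have "\<bar>(1 + t\<^sup>2) * ((1 - q) * x * y)\<bar> \<le> 2 * \<bar>(1 - q) * x * y\<bar>"
      unfolding abs_mult[of "1 + t\<^sup>2"] using t2 by (intro mult_mono) auto
    moreover have "\<bar>t * ((1 - q) * (x\<^sup>2 + y\<^sup>2))\<bar> \<le> 1 * \<bar>(1 - q) * (x\<^sup>2 + y\<^sup>2)\<bar>"
      unfolding abs_mult[of t] using t1 by (intro mult_mono) auto
    ultimately show "\<bar>- 2 * t + t * t\<^sup>2 - (1 + t\<^sup>2) * ((1 - q) * x * y) + t * ((1 - q) * (x\<^sup>2 + y\<^sup>2))\<bar> \<le> D"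
      using t1 unfolding D_def by linarith
  qed auto
  finally show "\<bar>v0 x y (\<rho> * q ^ k) q - 1\<bar> \<le> D * \<bar>q\<bar> ^ k" by (simp add: t_def mult.commute)
qed

context mehler_convergent
begin

text \<open>The q-difference equation for the Mehler sum: \<open>mehler_sum_q_shift\<close> expresses the value at \<open>\<rho> * q\<close> by
\<open>G 1\<close> and \<open>G 2\<close>, and the recurrence expresses these by \<open>G 0\<close>.\<close>

lemma v0_mehler_sum:
  "v0 x y \<rho> q * G 0 = (1 - \<rho>\<^sup>2) * (1 - \<rho>\<^sup>2 * q) * mehler_sum 0 (\<rho> * q) x y q"
proof -
  define a b where "a = 1 - \<rho>\<^sup>2" and "b = 1 - \<rho>\<^sup>2 * q"
  have G1: "a * G 1 = (x - \<rho> * y) * G 0"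
    using mehler_sum_recurrence[of 0] by (simp add: a_def)
  have G2: "b * G 2 = (x - \<rho> * y * q) * G 1 - G 0"
    using mehler_sum_recurrence[of 1] by (simp add: b_def numeral_2_eq_2)
  have shift: "mehler_sum 0 (\<rho> * q) x y q = G 0 - (1 - q) * \<rho> * (y * G 1 - \<rho> * G 2)"
    using mehler_sum_q_shift by (simp only: mult.commute)
  have "a * b * mehler_sum 0 (\<rho> * q) x y q = a * b * G 0 - (1 - q) * \<rho> * (y * b * (a * G 1) - \<rho> * (a * (b * G 2)))"
    unfolding shift by (simp add: algebra_simps)
  also have "a * (b * G 2) = (x - \<rho> * y * q) * (a * G 1) - a * G 0"
    unfolding G2 by (simp add: algebra_simps)
  finally have "a * b * mehler_sum 0 (\<rho> * q) x y q =
     (a * b - (1 - q) * \<rho> * (y * b * (x - \<rho> * y) - \<rho> * ((x - \<rho> * y * q) * (x - \<rho> * y) - a))) * G 0"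
    unfolding G1 by (simp add: algebra_simps)
  also have "a * b - (1 - q) * \<rho> * (y * b * (x - \<rho> * y) - \<rho> * ((x - \<rho> * y * q) * (x - \<rho> * y) - a)) = v0 x y \<rho> q"
    unfolding a_def b_def v0_def by (simp add: power2_eq_square algebra_simps)
  finally show ?thesis by (simp add: a_def b_def)
qed

end

lemma mehler_sum_continuous_at_0:
  assumes "summable (mehler_term 0 K x y q)" "K \<noteq> 0"
  shows "isCont (\<lambda>\<rho>. mehler_sum 0 \<rho> x y q) 0" "mehler_sum 0 0 x y q = 1"
proof -
  define c where "c n = q_hermite n x q * q_hermite n y q / q_fact n q" for n
  have t: "mehler_term 0 \<rho> x y q = (\<lambda>n. c n * \<rho> ^ n)" for \<rho>
    by (auto simp: mehler_term_def c_def)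
  show "isCont (\<lambda>\<rho>. mehler_sum 0 \<rho> x y q) 0"
    unfolding mehler_sum_def t by (rule isCont_powser[of _ K]) (use assms t in auto)
  have "mehler_sum 0 0 x y q = c 0" unfolding mehler_sum_def t by (rule powser_zero)
  thus "mehler_sum 0 0 x y q = 1" by (simp add: c_def)
qed

text \<open>Iterating the q-difference equation moves \<open>\<rho>\<close> to \<open>\<rho> * q ^ n\<close>, which tends to 0, where the Mehler sum is continuous
with value 1. The accumulated factors converge to the infinite products that define \<open>f_CN_factor\<close>.\<close>

theorem q_mehler:
  assumes q: "\<bar>q\<bar> < 1" and \<rho>: "\<bar>\<rho>\<bar> < 1" and xy: "x \<in> q_support q" "y \<in> q_support q"
  shows "mehler_sum 0 \<rho> x y q = f_CN_factor x y \<rho> q" "f_CN_factor x y \<rho> q \<noteq> 0"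
proof -
  have small: "\<bar>\<rho> * q ^ n\<bar> < 1" for n
  proof -
    have "\<bar>q\<bar> ^ n \<le> 1" using q by (simp add: power_le_one)
    hence "\<bar>\<rho>\<bar> * \<bar>q\<bar> ^ n \<le> \<bar>\<rho>\<bar>" by (simp add: mult_left_le)
    thus ?thesis using \<rho> by (simp add: abs_mult power_abs)
  qed
  define V where "V k = v0 x y (\<rho> * q ^ k) q" for k
  have Vpos: "V k > 0" for k unfolding V_def by (intro v0_pos q small xy)
  have convV: "convergent_prod (\<lambda>k. 1 / V k)"
    using convergent_prod_v0[OF q \<rho>, of x y] by (simp add: V_def divide_inverse)
  have iter: "mehler_sum 0 \<rho> x y q = q_poch (\<rho>\<^sup>2) (2 * n) q * mehler_sum 0 (\<rho> * q ^ n) x y q * (\<Prod>k<n. 1 / V k)" for n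
  proof (induction n)
    case (Suc n)
    interpret m: mehler_convergent "\<rho> * q ^ n" x y q
      by (rule mehler_convergent_less_1[OF q small xy])
    have e: "(\<rho> * q ^ n)\<^sup>2 = \<rho>\<^sup>2 * q ^ (2 * n)" "\<rho> * q ^ n * q = \<rho> * q ^ Suc n"
      by (simp_all add: power_mult_distrib power_mult[symmetric] mult.commute)
    have "V n * mehler_sum 0 (\<rho> * q ^ n) x y q = (1 - \<rho>\<^sup>2 * q ^ (2 * n)) * (1 - \<rho>\<^sup>2 * q ^ Suc (2 * n)) * mehler_sum 0 (\<rho> * q ^ Suc n) x y q"
      using m.v0_mehler_sum unfolding V_def e by (simp only: power_Suc2 mult.assoc)
    hence "mehler_sum 0 (\<rho> * q ^ n) x y q = (1 - \<rho>\<^sup>2 * q ^ (2 * n)) * (1 - \<rho>\<^sup>2 * q ^ Suc (2 * n)) * mehler_sum 0 (\<rho> * q ^ Suc n) x y q * (1 / V n)"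
      using Vpos[of n] by (simp add: field_simps)
    moreover have "q_poch (\<rho>\<^sup>2) (2 * Suc n) q = q_poch (\<rho>\<^sup>2) (2 * n) q * (1 - \<rho>\<^sup>2 * q ^ (2 * n)) * (1 - \<rho>\<^sup>2 * q ^ Suc (2 * n))"
      by (simp add: q_poch_Suc)
    ultimately show ?case using Suc.IH by (simp add: mult_ac)
  qed simp
  have convP: "convergent_prod (\<lambda>i. 1 - \<rho>\<^sup>2 * q ^ i)"
    by (rule convergent_prod_geometric[OF q, of _ "\<rho>\<^sup>2"]) (simp add: abs_mult power_abs)
  have "(\<lambda>n. \<Prod>i<n. 1 - \<rho>\<^sup>2 * q ^ i) \<longlonglongrightarrow> (\<Prod>i. 1 - \<rho>\<^sup>2 * q ^ i)"
    using convergent_prod_LIMSEQ[OF convP] by (simp add: LIMSEQ_lessThan_iff_atMost)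
  hence "(\<lambda>n. q_poch (\<rho>\<^sup>2) n q) \<longlonglongrightarrow> q_poch_inf (\<rho>\<^sup>2) q" by (simp add: q_poch_def q_poch_inf_def)
  hence l1: "(\<lambda>n. q_poch (\<rho>\<^sup>2) (2 * n) q) \<longlonglongrightarrow> q_poch_inf (\<rho>\<^sup>2) q"
    by (rule filterlim_compose) (auto intro: filterlim_subseq simp: strict_mono_def)
  interpret half: mehler_convergent "1 / 2" x y q by (rule mehler_convergent_less_1[OF q _ xy]) simp
  note cont = mehler_sum_continuous_at_0[OF half.summable_mehler_term]
  have "(\<lambda>n. \<rho> * q ^ n) \<longlonglongrightarrow> \<rho> * 0" using q by (intro tendsto_intros LIMSEQ_power_zero) auto
  hence "(\<lambda>n. mehler_sum 0 (\<rho> * q ^ n) x y q) \<longlonglongrightarrow> mehler_sum 0 0 x y q"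
    by (intro isCont_tendsto_compose[OF cont(1)]) auto
  hence l2: "(\<lambda>n. mehler_sum 0 (\<rho> * q ^ n) x y q) \<longlonglongrightarrow> 1" by (simp add: cont(2))
  have l3: "(\<lambda>n. \<Prod>k<n. 1 / V k) \<longlonglongrightarrow> (\<Prod>k. 1 / V k)"
    using convergent_prod_LIMSEQ[OF convV] by (simp add: LIMSEQ_lessThan_iff_atMost)
  have "(\<lambda>n. q_poch (\<rho>\<^sup>2) (2 * n) q * mehler_sum 0 (\<rho> * q ^ n) x y q * (\<Prod>k<n. 1 / V k)) \<longlonglongrightarrow> q_poch_inf (\<rho>\<^sup>2) q * 1 * (\<Prod>k. 1 / V k)"
    by (intro tendsto_mult l1 l2 l3)
  hence "(\<lambda>n::nat. mehler_sum 0 \<rho> x y q) \<longlonglongrightarrow> f_CN_factor x y \<rho> q"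
    unfolding iter[symmetric] by (simp add: f_CN_factor_def V_def)
  thus "mehler_sum 0 \<rho> x y q = f_CN_factor x y \<rho> q" by (simp add: LIMSEQ_const_iff)
  have "q_poch_inf (\<rho>\<^sup>2) q \<noteq> 0" unfolding q_poch_inf_def
  proof (rule prodinf_nonzero[OF convP])
    show "1 - \<rho>\<^sup>2 * q ^ i \<noteq> 0" for i using q_poch_sq_pos(1)[of q \<rho> i] q \<rho> by force
  qed
  moreover have "(\<Prod>k. 1 / V k) \<noteq> 0"
    by (rule prodinf_nonzero[OF convV]) (use Vpos in \<open>simp add: less_imp_neq[symmetric]\<close>)
  ultimately show "f_CN_factor x y \<rho> q \<noteq> 0" by (simp add: f_CN_factor_def V_def)
qed

section \<open>The q-Kibble-Slepian series\<close>

lemma has_sum_times: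
  fixes f :: "'a \<Rightarrow> real" and g :: "'b \<Rightarrow> real"
  assumes f: "(f has_sum a) A" and g: "(g has_sum b) B"
  shows "((\<lambda>(x, y). f x * g y) has_sum (a * b)) (A \<times> B)"
proof -
  have nf: "(\<lambda>x. \<bar>f x\<bar>) summable_on A" and ng: "(\<lambda>x. \<bar>g x\<bar>) summable_on B"
    using f g summable_on_iff_abs_summable_on_real[of f A] summable_on_iff_abs_summable_on_real[of g B]
    by (auto simp: summable_on_def)
  have "(\<lambda>z. \<bar>f (fst z)\<bar> * \<bar>g (snd z)\<bar>) summable_on (A \<times> B)"
  proof (rule summable_on_SigmaI)
    show "((\<lambda>y. \<bar>f (fst (x, y))\<bar> * \<bar>g (snd (x, y))\<bar>) has_sum (\<bar>f x\<bar> * (\<Sum>\<^sub>\<infinity>y\<in>B. \<bar>g y\<bar>))) B" for x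
      using has_sum_cmult_right[OF has_sum_infsum[OF ng], of "\<bar>f x\<bar>"] by simp
    show "(\<lambda>x. \<bar>f x\<bar> * (\<Sum>\<^sub>\<infinity>y\<in>B. \<bar>g y\<bar>)) summable_on A" by (intro summable_on_cmult_left nf)
  qed auto
  hence "(\<lambda>z. norm ((case z of (x, y) \<Rightarrow> f x * g y))) summable_on (A \<times> B)"
    by (simp add: case_prod_unfold abs_mult)
  hence sm: "(\<lambda>(x, y). f x * g y) summable_on (A \<times> B)" by (rule abs_summable_summable)
  show ?thesis
  proof (rule has_sum_SigmaI[OF _ _ sm])
    show "((\<lambda>y. case (x, y) of (x, y) \<Rightarrow> f x * g y) has_sum (f x * b)) B" for x
      using has_sum_cmult_right[OF g] by simp
    show "((\<lambda>x. f x * b) has_sum (a * b)) A" by (rule has_sum_cmult_left[OF f])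
  qed
qed

definition kibble_slepian_term ::
  "real \<Rightarrow> real \<Rightarrow> real \<Rightarrow> real \<Rightarrow> real \<Rightarrow> real \<Rightarrow> real \<Rightarrow> nat \<times> nat \<times> nat \<Rightarrow> real" where
  "kibble_slepian_term \<rho>12 \<rho>13 \<rho>23 x1 x2 x3 q = (\<lambda>(a, b, c).
     \<rho>12 ^ a / q_fact a q * (\<rho>13 ^ b / q_fact b q) * (\<rho>23 ^ c / q_fact c q)
     * q_hermite (a + b) x1 q * q_hermite (a + c) x2 q * q_hermite (b + c) x3 q)"

text \<open>The common refinement of the two series: summing over \<open>k + j = a\<close> gives the Kibble-Slepian term by
\<open>q_newton_expansion\<close>, and summing over \<open>j + b = m\<close>, \<open>j + c = n\<close> gives products of Mehler terms by
\<open>q_hermite_linearization\<close>.\<close>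

definition kibble_slepian_refined ::
  "real \<Rightarrow> real \<Rightarrow> real \<Rightarrow> real \<Rightarrow> real \<Rightarrow> real \<Rightarrow> real \<Rightarrow> nat \<times> nat \<times> nat \<times> nat \<Rightarrow> real" where
  "kibble_slepian_refined \<rho>12 \<rho>13 \<rho>23 x1 x2 x3 q = (\<lambda>(k, j, b, c).
     q_poch_hom \<rho>12 (\<rho>13 * \<rho>23) k q / q_fact k q * ((\<rho>13 * \<rho>23) ^ j / q_fact j q)
     * (\<rho>13 ^ b / q_fact b q) * (\<rho>23 ^ c / q_fact c q)
     * q_hermite (k + j + b) x1 q * q_hermite (k + j + c) x2 q * q_hermite (b + c) x3 q)"

lemma geometric_has_sum:
  fixes t :: real
  assumes "0 \<le> t" "t < 1"
  shows "((\<lambda>n. t ^ n) has_sum (1 / (1 - t))) UNIV"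
  using assms by (intro norm_summable_imp_has_sum geometric_sums) (auto simp: power_abs intro: summable_geometric)

text \<open>The four indices \<open>k, j, b, c\<close> occur in the total degree \<open>2 * (k + j + b + c)\<close> of the Hermite factors and each
index belongs to one factorial, so the powers of \<open>1 - q\<close> cancel. What remains is a product of four geometric series.\<close>

lemma kibble_slepian_refined_summable:
  assumes q: "\<bar>q\<bar> < 1" and \<rho>: "\<bar>\<rho>12\<bar> < 1" "\<bar>\<rho>13\<bar> < 1" "\<bar>\<rho>23\<bar> < 1"
    and x: "x1 \<in> q_support q" "x2 \<in> q_support q" "x3 \<in> q_support q"
  shows "kibble_slepian_refined \<rho>12 \<rho>13 \<rho>23 x1 x2 x3 q summable_on UNIV"
proof -
  \<comment> \<open>A common bound strictly between the moduli of the parameters and 1.\<close>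
  define r where "r = (max \<bar>\<rho>12\<bar> (max \<bar>\<rho>13\<bar> \<bar>\<rho>23\<bar>) + 1) / 2"
  have r: "\<bar>\<rho>12\<bar> < r" "\<bar>\<rho>13\<bar> < r" "\<bar>\<rho>23\<bar> < r" "r < 1" "0 < r" using \<rho> by (auto simp: r_def)
  have d: "\<bar>\<rho>13 * \<rho>23\<bar> \<le> r"
  proof -
    have "\<bar>\<rho>13\<bar> * \<bar>\<rho>23\<bar> \<le> \<bar>\<rho>13\<bar> * 1" using \<rho> by (intro mult_left_mono) auto
    thus ?thesis using r by (simp add: abs_mult)
  qed
  obtain R where R: "R > 1" "r * R ^ 3 < 1" using exists_growth_margin[OF r(4)] by blast
  define s where "s = sqrt (1 - q)"
  have s: "s > 0" "1 - q = s * s" using q by (auto simp: s_def)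
  obtain A1 where A1: "A1 > 0" "\<And>n. \<bar>q_hermite n x1 q\<bar> \<le> A1 * (R / s) ^ n"
    using q_hermite_growth[OF q x(1) R(1)] unfolding s_def by blast
  obtain A2 where A2: "A2 > 0" "\<And>n. \<bar>q_hermite n x2 q\<bar> \<le> A2 * (R / s) ^ n"
    using q_hermite_growth[OF q x(2) R(1)] unfolding s_def by blast
  obtain A3 where A3: "A3 > 0" "\<And>n. \<bar>q_hermite n x3 q\<bar> \<le> A3 * (R / s) ^ n"
    using q_hermite_growth[OF q x(3) R(1)] unfolding s_def by blast
  obtain C where C: "C > 0" "\<And>n. 1 / q_fact n q \<le> C * (R * (s * s)) ^ n"
    using inverse_q_fact_growth[OF q R(1)] unfolding s(2) by blast
  obtain D where D: "D > 0" "\<And>n. \<bar>q_poch_hom \<rho>12 (\<rho>13 * \<rho>23) n q\<bar> \<le> D * r ^ n"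
    using q_poch_hom_growth[OF q r(1)] by blast
  define \<theta> where "\<theta> = r * R ^ 3"
  have th: "0 \<le> \<theta>" "\<theta> < 1" using R r by (auto simp: \<theta>_def)
  define M where "M = D * C ^ 4 * A1 * A2 * A3"
  have coeff: "\<bar>v / q_fact n q\<bar> \<le> w * (C * (R * (s * s)) ^ n)" if "\<bar>v\<bar> \<le> w" for v w n
  proof -
    have pos: "q_fact n q > 0" using q by (intro q_fact_pos) auto
    have "\<bar>v / q_fact n q\<bar> = \<bar>v\<bar> * (1 / q_fact n q)" using pos by simp
    also have "\<dots> \<le> w * (C * (R * (s * s)) ^ n)" using that C pos by (intro mult_mono) auto
    finally show ?thesis .
  qed
  have pw: "\<bar>t ^ n\<bar> \<le> r ^ n" if "\<bar>t\<bar> \<le> r" for t n using that by (simp add: power_abs power_mono)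
  have bd: "norm (kibble_slepian_refined \<rho>12 \<rho>13 \<rho>23 x1 x2 x3 q (k, j, b, c)) \<le> M * (\<theta> ^ k * (\<theta> ^ j * (\<theta> ^ b * \<theta> ^ c)))" for k j b c
  proof -
    have "norm (kibble_slepian_refined \<rho>12 \<rho>13 \<rho>23 x1 x2 x3 q (k, j, b, c)) =
      \<bar>q_poch_hom \<rho>12 (\<rho>13 * \<rho>23) k q / q_fact k q\<bar> * \<bar>(\<rho>13 * \<rho>23) ^ j / q_fact j q\<bar>
     * \<bar>\<rho>13 ^ b / q_fact b q\<bar> * \<bar>\<rho>23 ^ c / q_fact c q\<bar>
     * \<bar>q_hermite (k + j + b) x1 q\<bar> * \<bar>q_hermite (k + j + c) x2 q\<bar> * \<bar>q_hermite (b + c) x3 q\<bar>"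
      by (simp only: kibble_slepian_refined_def case_prod_conv real_norm_def abs_mult)
    also have "\<dots> \<le> (D * r ^ k * (C * (R * (s * s)) ^ k)) * (r ^ j * (C * (R * (s * s)) ^ j))
      * (r ^ b * (C * (R * (s * s)) ^ b)) * (r ^ c * (C * (R * (s * s)) ^ c))
      * (A1 * (R / s) ^ (k + j + b)) * (A2 * (R / s) ^ (k + j + c)) * (A3 * (R / s) ^ (b + c))"
      using R(1) r s(1) C(1) D A1 A2 A3 d by (intro mult_mono coeff pw) auto
    also have "\<dots> = M * ((r * (R * (s * s)) * (R / s) * (R / s)) ^ k * ((r * (R * (s * s)) * (R / s) * (R / s)) ^ j
        * ((r * (R * (s * s)) * (R / s) * (R / s)) ^ b * (r * (R * (s * s)) * (R / s) * (R / s)) ^ c)))"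
      unfolding M_def by (simp only: power_add power_mult_distrib mult_ac power4_eq_xxxx)
    also have "r * (R * (s * s)) * (R / s) * (R / s) = \<theta>"
      using s(1) by (simp add: \<theta>_def field_simps power3_eq_cube)
    finally show ?thesis .
  qed
  note g = geometric_has_sum[OF th]
  have "((\<lambda>(k, j, b, c). \<theta> ^ k * (\<theta> ^ j * (\<theta> ^ b * \<theta> ^ c))) has_sum
     (1 / (1 - \<theta>) * (1 / (1 - \<theta>) * (1 / (1 - \<theta>) * (1 / (1 - \<theta>)))))) UNIV"
    using has_sum_times[OF g has_sum_times[OF g has_sum_times[OF g g]]] by (simp add: case_prod_unfold)
  hence "(\<lambda>z. M * (case z of (k, j, b, c) \<Rightarrow> \<theta> ^ k * (\<theta> ^ j * (\<theta> ^ b * \<theta> ^ c)))) summable_on UNIV"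
    by (intro summable_on_cmult_right) (auto simp: summable_on_def)
  hence "(\<lambda>z. norm (kibble_slepian_refined \<rho>12 \<rho>13 \<rho>23 x1 x2 x3 q z)) summable_on UNIV"
    by (rule Infinite_Sum.abs_summable_on_comparison_test') (use bd in auto)
  thus ?thesis by (rule abs_summable_summable)
qed

lemma kibble_slepian_from_refined:
  assumes q: "-1 < q" "q \<le> 1"
    and S: "(kibble_slepian_refined \<rho>12 \<rho>13 \<rho>23 x1 x2 x3 q has_sum S) UNIV"
  shows "(kibble_slepian_term \<rho>12 \<rho>13 \<rho>23 x1 x2 x3 q has_sum S) UNIV"
proof -
  let ?U = "kibble_slepian_refined \<rho>12 \<rho>13 \<rho>23 x1 x2 x3 q"
  have "((\<lambda>((a, b, c), k). ?U (k, a - k, b, c)) has_sum S) (SIGMA z:UNIV. {..fst z})"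
    by (subst has_sum_reindex_bij_witness[where h = ?U and T = UNIV and s' = S
          and j = "\<lambda>((a, b, c), k). (k, a - k, b, c)" and i = "\<lambda>(k, j, b, c). ((k + j, b, c), k)"])
       (use S in auto)
  thus ?thesis
  proof (rule has_sum_SigmaD)
    fix z :: "nat \<times> nat \<times> nat"
    obtain a b c where z: "z = (a, b, c)" by (cases z)
    have "(\<Sum>k\<le>a. ?U (k, a - k, b, c)) = (\<Sum>k\<le>a. q_poch_hom \<rho>12 (\<rho>13 * \<rho>23) k q / q_fact k q * ((\<rho>13 * \<rho>23) ^ (a - k) / q_fact (a - k) q))
        * ((\<rho>13 ^ b / q_fact b q) * (\<rho>23 ^ c / q_fact c q)
           * q_hermite (a + b) x1 q * q_hermite (a + c) x2 q * q_hermite (b + c) x3 q)"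
      unfolding sum_distrib_right by (rule sum.cong) (auto simp: kibble_slepian_refined_def)
    also have "\<dots> = kibble_slepian_term \<rho>12 \<rho>13 \<rho>23 x1 x2 x3 q z"
      unfolding q_newton_expansion[OF q, symmetric] by (simp add: kibble_slepian_term_def z)
    finally show "((\<lambda>y. case (z, y) of (x, xa) \<Rightarrow> (case x of (a, b, c) \<Rightarrow> \<lambda>k. ?U (k, a - k, b, c)) xa) has_sum
        kibble_slepian_term \<rho>12 \<rho>13 \<rho>23 x1 x2 x3 q z) {..fst z}"
      by (intro has_sum_finiteI) (auto simp: z)
  qed
qed

lemma mehler_products_from_refined:
  assumes q: "-1 < q" "q \<le> 1"
    and S: "(kibble_slepian_refined \<rho>12 \<rho>13 \<rho>23 x1 x2 x3 q has_sum S) UNIV"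
  shows "((\<lambda>(k, m, n). q_poch_hom \<rho>12 (\<rho>13 * \<rho>23) k q / q_fact k q *
      (mehler_term k \<rho>13 x1 x3 q m * mehler_term k \<rho>23 x2 x3 q n)) has_sum S) UNIV"
proof -
  let ?U = "kibble_slepian_refined \<rho>12 \<rho>13 \<rho>23 x1 x2 x3 q"
  have "((\<lambda>((k, m, n), j). ?U (k, j, m - j, n - j)) has_sum S) (SIGMA z:UNIV. {..min (fst (snd z)) (snd (snd z))})"
    by (subst has_sum_reindex_bij_witness[where h = ?U and T = UNIV and s' = S
          and j = "\<lambda>((k, m, n), j). (k, j, m - j, n - j)" and i = "\<lambda>(k, j, b, c). ((k, j + b, j + c), j)"])
       (use S in auto)
  thus ?thesis
  proof (rule has_sum_SigmaD)
    fix z :: "nat \<times> nat \<times> nat"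
    obtain k m n where z: "z = (k, m, n)" by (cases z)
    have "?U (k, j, m - j, n - j) = q_poch_hom \<rho>12 (\<rho>13 * \<rho>23) k q / q_fact k q * (\<rho>13 ^ m * \<rho>23 ^ n)
         * q_hermite (m + k) x1 q * q_hermite (n + k) x2 q *
         (q_hermite ((m - j) + (n - j)) x3 q / (q_fact j q * q_fact (m - j) q * q_fact (n - j) q))"
      if "j \<le> min m n" for j
    proof -
      have e: "k + j + (m - j) = m + k" "k + j + (n - j) = n + k" using that by auto
      have "\<rho>13 ^ m * \<rho>23 ^ n = (\<rho>13 * \<rho>23) ^ j * \<rho>13 ^ (m - j) * \<rho>23 ^ (n - j)"
        using that power_add[of \<rho>13 j "m - j"] power_add[of \<rho>23 j "n - j"] by (simp add: power_mult_distrib)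
      thus ?thesis unfolding kibble_slepian_refined_def case_prod_conv e by simp
    qed
    hence "(\<Sum>j\<le>min m n. ?U (k, j, m - j, n - j)) = q_poch_hom \<rho>12 (\<rho>13 * \<rho>23) k q / q_fact k q * (\<rho>13 ^ m * \<rho>23 ^ n)
         * q_hermite (m + k) x1 q * q_hermite (n + k) x2 q * (q_hermite m x3 q * q_hermite n x3 q / (q_fact m q * q_fact n q))"
      unfolding q_hermite_linearization[OF q] sum_distrib_left by (intro sum.cong) auto
    also have "\<dots> = q_poch_hom \<rho>12 (\<rho>13 * \<rho>23) k q / q_fact k q *
      (mehler_term k \<rho>13 x1 x3 q m * mehler_term k \<rho>23 x2 x3 q n)"
      by (simp add: mehler_term_def)
    finally show "((\<lambda>y. case (z, y) of (x, xa) \<Rightarrow> (case x of (k, m, n) \<Rightarrow> \<lambda>j. ?U (k, j, m - j, n - j)) xa) has_sum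
        (case z of (k, m, n) \<Rightarrow> q_poch_hom \<rho>12 (\<rho>13 * \<rho>23) k q / q_fact k q *
      (mehler_term k \<rho>13 x1 x3 q m * mehler_term k \<rho>23 x2 x3 q n))) {..min (fst (snd z)) (snd (snd z))}"
      by (intro has_sum_finiteI) (auto simp: z)
  qed
qed

text \<open>Summing the refined series in two ways. For fixed \<open>k\<close> the double series of Mehler terms factors into two Mehler
sums, which are Al-Salam--Chihara polynomials up to the factors \<open>f_CN_factor\<close>.\<close>

theorem asc_series_kibble_slepian:
  assumes q: "\<bar>q\<bar> < 1" and \<rho>: "\<bar>\<rho>12\<bar> < 1" "\<bar>\<rho>13\<bar> < 1" "\<bar>\<rho>23\<bar> < 1"
    and x: "x1 \<in> q_support q" "x2 \<in> q_support q" "x3 \<in> q_support q"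
  shows "summable (asc_term \<rho>12 \<rho>13 \<rho>23 x1 x2 x3 q)"
    "(\<Sum>\<^sub>\<infinity>z. kibble_slepian_term \<rho>12 \<rho>13 \<rho>23 x1 x2 x3 q z) =
       f_CN_factor x1 x3 \<rho>13 q * f_CN_factor x2 x3 \<rho>23 q * (\<Sum>s. asc_term \<rho>12 \<rho>13 \<rho>23 x1 x2 x3 q s)"
proof -
  have q': "-1 < q" "q \<le> 1" using q by auto
  define F where "F = f_CN_factor x1 x3 \<rho>13 q * f_CN_factor x2 x3 \<rho>23 q"
  interpret m1: mehler_convergent \<rho>13 x1 x3 q by (rule mehler_convergent_less_1[OF q \<rho>(2) x(1,3)])
  interpret m2: mehler_convergent \<rho>23 x2 x3 q by (rule mehler_convergent_less_1[OF q \<rho>(3) x(2,3)])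
  have F0: "F \<noteq> 0" using q_mehler(2)[OF q \<rho>(2) x(1,3)] q_mehler(2)[OF q \<rho>(3) x(2,3)] by (simp add: F_def)
  obtain S where S: "(kibble_slepian_refined \<rho>12 \<rho>13 \<rho>23 x1 x2 x3 q has_sum S) UNIV"
    using kibble_slepian_refined_summable[OF q \<rho> x] by (auto simp: summable_on_def)
  define w where "w k = q_poch_hom \<rho>12 (\<rho>13 * \<rho>23) k q / q_fact k q" for k
  have G1: "(mehler_term k \<rho>13 x1 x3 q has_sum m1.G k) UNIV" for k
    by (rule norm_summable_imp_has_sum[OF mehler_term_abs_summable[OF q \<rho>(2) x(1,3)] m1.G_sums])
  have G2: "(mehler_term k \<rho>23 x2 x3 q has_sum m2.G k) UNIV" for k
    by (rule norm_summable_imp_has_sum[OF mehler_term_abs_summable[OF q \<rho>(3) x(2,3)] m2.G_sums])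
  have "((\<lambda>(k, z). w k * (case z of (m, n) \<Rightarrow> mehler_term k \<rho>13 x1 x3 q m * mehler_term k \<rho>23 x2 x3 q n)) has_sum S) (UNIV \<times> UNIV)"
    using mehler_products_from_refined[OF q' S] by (simp add: w_def case_prod_unfold)
  hence "((\<lambda>k. w k * (m1.G k * m2.G k)) has_sum S) UNIV"
  proof (rule has_sum_SigmaD)
    fix k :: nat
    show "((\<lambda>z. case (k, z) of (k, z) \<Rightarrow> w k * (case z of (m, n) \<Rightarrow> mehler_term k \<rho>13 x1 x3 q m * mehler_term k \<rho>23 x2 x3 q n))
       has_sum w k * (m1.G k * m2.G k)) UNIV"
      using has_sum_cmult_right[OF has_sum_times[OF G1 G2]] by simp
  qed
  hence "(\<lambda>k. w k * (m1.G k * m2.G k)) sums S" by (rule has_sum_imp_sums)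
  moreover have "w k * (m1.G k * m2.G k) = F * asc_term \<rho>12 \<rho>13 \<rho>23 x1 x2 x3 q k" for k
  proof -
    have "q_poch (\<rho>13\<^sup>2) k q > 0" "q_poch (\<rho>23\<^sup>2) k q > 0"
      using q_poch_sq_pos(2)[OF q'] \<rho> by auto
    hence "m1.G k = al_salam_chihara k x1 x3 \<rho>13 q * m1.G 0 / q_poch (\<rho>13\<^sup>2) k q"
      "m2.G k = al_salam_chihara k x2 x3 \<rho>23 q * m2.G 0 / q_poch (\<rho>23\<^sup>2) k q"
      unfolding m1.al_salam_chihara_mehler_sum m2.al_salam_chihara_mehler_sum by simp_all
    thus ?thesis
      unfolding w_def F_def asc_term_def q_mehler(1)[OF q \<rho>(2) x(1,3)] q_mehler(1)[OF q \<rho>(3) x(2,3)]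
      by simp
  qed
  ultimately have sums: "(\<lambda>k. F * asc_term \<rho>12 \<rho>13 \<rho>23 x1 x2 x3 q k) sums S" by simp
  show smb: "summable (asc_term \<rho>12 \<rho>13 \<rho>23 x1 x2 x3 q)"
    using sums_summable[OF sums] F0 by (simp add: summable_cmult_iff)
  have "S = F * (\<Sum>s. asc_term \<rho>12 \<rho>13 \<rho>23 x1 x2 x3 q s)"
    using sums_unique2[OF sums sums_mult[OF summable_sums[OF smb]]] .
  thus "(\<Sum>\<^sub>\<infinity>z. kibble_slepian_term \<rho>12 \<rho>13 \<rho>23 x1 x2 x3 q z) =
       f_CN_factor x1 x3 \<rho>13 q * f_CN_factor x2 x3 \<rho>23 q * (\<Sum>s. asc_term \<rho>12 \<rho>13 \<rho>23 x1 x2 x3 q s)"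
    using infsumI[OF kibble_slepian_from_refined[OF q' S]] by (simp add: F_def)
qed

lemma f_CN_factor_commute: "f_CN_factor x y \<rho> q = f_CN_factor y x \<rho> q"
  by (simp add: f_CN_factor_def v0_def mult_ac add_ac)

lemma infsum_kibble_slepian_swap:
  "(\<Sum>\<^sub>\<infinity>z. kibble_slepian_term \<rho>12 \<rho>13 \<rho>23 x1 x2 x3 q z) =
   (\<Sum>\<^sub>\<infinity>z. kibble_slepian_term \<rho>13 \<rho>12 \<rho>23 x1 x3 x2 q z)"
  by (rule infsum_reindex_bij_witness[where i = "\<lambda>(a, b, c). (b, a, c)" and j = "\<lambda>(a, b, c). (b, a, c)"])
     (auto simp: kibble_slepian_term_def mult_ac add_ac)

theorem asc_series_exchange_less_1:
  assumes q: "\<bar>q\<bar> < 1" and \<rho>: "\<bar>\<rho>12\<bar> < 1" "\<bar>\<rho>13\<bar> < 1" "\<bar>\<rho>23\<bar> < 1"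
    and x: "x1 \<in> q_support q" "x2 \<in> q_support q" "x3 \<in> q_support q"
  shows "(\<Sum>s. asc_term \<rho>12 \<rho>13 \<rho>23 x1 x2 x3 q s) =
    f_CN_ratio x1 x2 \<rho>12 x3 \<rho>13 q * (\<Sum>k. asc_term \<rho>13 \<rho>12 \<rho>23 x1 x3 x2 q k)"
proof -
  have "f_CN_factor x1 x3 \<rho>13 q * f_CN_factor x2 x3 \<rho>23 q * (\<Sum>s. asc_term \<rho>12 \<rho>13 \<rho>23 x1 x2 x3 q s) =
        f_CN_factor x1 x2 \<rho>12 q * f_CN_factor x3 x2 \<rho>23 q * (\<Sum>k. asc_term \<rho>13 \<rho>12 \<rho>23 x1 x3 x2 q k)"
    unfolding asc_series_kibble_slepian(2)[OF q \<rho> x, symmetric]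
      asc_series_kibble_slepian(2)[OF q \<rho>(2,1,3) x(1,3,2), symmetric]
    by (rule infsum_kibble_slepian_swap)
  moreover have "f_CN_factor x1 x3 \<rho>13 q \<noteq> 0" "f_CN_factor x2 x3 \<rho>23 q \<noteq> 0"
    by (intro q_mehler(2) q \<rho> x)+
  moreover have "q \<noteq> 1" using q by auto
  ultimately show ?thesis
    by (simp add: f_CN_ratio_def f_CN_factor_commute[of x3 x2] field_simps)
qed

section \<open>Mehler's formula for Hermite polynomials\<close>

text \<open>Here too the quotient is a product of factors tending to 1; it compensates for the shift \<open>k\<close> in the bound
\<open>sqrt (fact (n + k))\<close> of the Hermite polynomials.\<close>

lemma fact_shift_growth:
  assumes R: "R > 1"
  shows "\<exists>C>0. \<forall>n. fact (n + k) / fact n \<le> C * (R :: real) ^ n"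
proof -
  have e: "(1 + real k * inverse (real (Suc i))) = real (i + 1 + k) / real (i + 1)" for i
    by (simp add: field_simps)
  have "(\<lambda>i. 1 + real k * inverse (real (Suc i))) \<longlonglongrightarrow> 1 + real k * 0"
    by (intro tendsto_intros LIMSEQ_inverse_real_of_nat)
  hence "(\<lambda>i. real (i + 1 + k) / real (i + 1)) \<longlonglongrightarrow> 1" unfolding e by simp
  from prod_le_geometric[OF this, of R] R obtain C where
    C: "C > 0" "\<And>n. \<bar>\<Prod>i<n. real (i + 1 + k) / real (i + 1)\<bar> \<le> C * R ^ n" by auto
  have "fact (n + k) / fact n = fact k * (\<Prod>i<n. real (i + 1 + k) / real (i + 1))" for n
  proof (induction n)
    case (Suc n)
    have "fact (Suc n + k) / fact (Suc n) = fact (n + k) / fact n * (real (n + 1 + k) / real (n + 1))"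
      by (simp add: mult.commute)
    thus ?case unfolding Suc.IH by (simp only: prod.lessThan_Suc mult.assoc)
  qed simp
  hence "fact (n + k) / fact n \<le> (fact k * C) * R ^ n" for n
    using mult_left_mono[OF order_trans[OF abs_ge_self C(2)], of "fact k" n] by (simp add: mult.assoc)
  thus ?thesis using C(1) by (intro exI[of _ "fact k * C"]) auto
qed

lemma mehler_convergent_at_1:
  assumes \<rho>: "\<bar>\<rho>\<bar> < 1"
  shows "mehler_convergent \<rho> x y 1"
proof
  fix k
  obtain R where R: "R > 1" "\<bar>\<rho>\<bar> * R ^ 3 < 1" using exists_growth_margin[OF \<rho>] by blast
  obtain A where A: "A > 0" "\<And>n. \<bar>q_hermite n x 1\<bar> \<le> A * R ^ n * sqrt (fact n)"
    using hermite_growth[OF R(1)] by blast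
  obtain B where B: "B > 0" "\<And>n. \<bar>q_hermite n y 1\<bar> \<le> B * R ^ n * sqrt (fact n)"
    using hermite_growth[OF R(1)] by blast
  obtain C where C: "C > 0" "\<And>n. fact (n + k) / fact n \<le> C * R ^ n"
    using fact_shift_growth[OF R(1)] by blast
  have bd: "norm (mehler_term k \<rho> x y 1 n) \<le> A * B * C * R ^ k * (\<bar>\<rho>\<bar> * R ^ 3) ^ n" for n
  proof -
    have "norm (mehler_term k \<rho> x y 1 n) = \<bar>\<rho>\<bar> ^ n / fact n * \<bar>q_hermite (n + k) x 1\<bar> * \<bar>q_hermite n y 1\<bar>"
      by (simp add: mehler_term_def abs_mult power_abs)
    also have "\<dots> \<le> \<bar>\<rho>\<bar> ^ n / fact n * (A * R ^ (n + k) * sqrt (fact (n + k))) * (B * R ^ n * sqrt (fact n))"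
      using A B R by (intro mult_mono) auto
    also have "\<dots> = A * B * (\<bar>\<rho>\<bar> ^ n * R ^ (n + k) * R ^ n) * (sqrt (fact (n + k)) * sqrt (fact n) / fact n)"
      by simp
    also have "sqrt (fact (n + k)) * sqrt (fact n) / fact n \<le> C * R ^ n"
    proof -
      have "fact n \<le> (fact (n + k) :: real)" by (rule fact_mono) simp
      hence "sqrt (fact (n + k)) * sqrt (fact n) \<le> sqrt (fact (n + k)) * sqrt (fact (n + k) :: real)"
        by (intro mult_left_mono) auto
      hence "sqrt (fact (n + k)) * sqrt (fact n) / fact n \<le> fact (n + k) / (fact n :: real)"
        by (intro divide_right_mono) auto
      thus ?thesis using C(2)[of n] by linarith
    qed
    hence "A * B * (\<bar>\<rho>\<bar> ^ n * R ^ (n + k) * R ^ n) * (sqrt (fact (n + k)) * sqrt (fact n) / fact n)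
        \<le> A * B * (\<bar>\<rho>\<bar> ^ n * R ^ (n + k) * R ^ n) * (C * R ^ n)"
      using A(1) B(1) R(1) by (intro mult_left_mono) auto
    also have "\<dots> = A * B * C * R ^ k * (\<bar>\<rho>\<bar> * R ^ 3) ^ n"
      by (simp add: power_add power_mult_distrib power3_eq_cube)
    finally show ?thesis .
  qed
  have "summable (\<lambda>n. A * B * C * R ^ k * (\<bar>\<rho>\<bar> * R ^ 3) ^ n)"
    using R by (intro summable_mult summable_geometric) auto
  thus "summable (mehler_term k \<rho> x y 1)"
    by (rule summable_comparison_test'[where N = 0]) (use bd in auto)
qed auto

lemma mehler_sum_deriv:
  assumes t: "\<bar>t\<bar> < 1"
  shows "((\<lambda>t. mehler_sum 0 t x y 1) has_field_derivative
    (y * mehler_sum 1 t x y 1 - t * mehler_sum 2 t x y 1)) (at t)"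
proof -
  define c where "c n = q_hermite n x 1 * q_hermite n y 1 / fact n" for n
  have c: "mehler_term 0 s x y 1 = (\<lambda>n. c n * s ^ n)" for s
    by (auto simp: mehler_term_def c_def)
  interpret m: mehler_convergent t x y 1 by (rule mehler_convergent_at_1[OF t])
  have "summable (\<lambda>n. c n * z ^ n)" if "norm z < 1" for z
  proof -
    interpret mz: mehler_convergent z x y 1 by (rule mehler_convergent_at_1) (use that in simp)
    show ?thesis using mz.summable_mehler_term[of 0] by (simp add: c)
  qed
  hence "((\<lambda>t. \<Sum>n. c n * t ^ n) has_field_derivative (\<Sum>n. diffs c n * t ^ n)) (at t)"
    by (rule termdiffs_strong') (use t in auto)
  moreover have "(\<lambda>n. diffs c n * t ^ n) = (\<lambda>n. t ^ n / q_fact n 1 * q_hermite (n + 1) x 1 * q_hermite (Suc n) y 1)"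
    by (auto simp: diffs_def c_def field_simps simp del: of_nat_Suc)
  hence "(\<Sum>n. diffs c n * t ^ n) = y * mehler_sum 1 t x y 1 - t * mehler_sum 2 t x y 1"
    using sums_unique[OF m.shifted_term_sums[of 1]] by (simp add: numeral_2_eq_2)
  ultimately show ?thesis by (simp add: mehler_sum_def c)
qed

text \<open>At \<open>q = 1\<close> the index shift is an honest derivative: \<open>G 0\<close> solves a linear differential equation of first order
in \<open>\<rho>\<close>, and the product \<open>W\<close> of \<open>G 0\<close> with the reciprocal of the claimed solution, up to a constant factor, has derivative 0.\<close>

theorem mehler_formula:
  assumes \<rho>: "\<bar>\<rho>\<bar> < 1"
  shows "mehler_sum 0 \<rho> x y 1 = exp (x\<^sup>2 / 2 - (x - \<rho> * y)\<^sup>2 / (2 * (1 - \<rho>\<^sup>2))) / sqrt (1 - \<rho>\<^sup>2)"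
proof -
  define W where "W t = mehler_sum 0 t x y 1 * exp ((x - t * y)\<^sup>2 / (2 * (1 - t\<^sup>2)) + ln (1 - t\<^sup>2) / 2)" for t
  have pos: "1 - t\<^sup>2 > 0" if "\<bar>t\<bar> < 1" for t :: real using that by (simp add: abs_square_less_1)
  have "(W has_field_derivative 0) (at t within {-1<..<1})" if "t \<in> {-1<..<1}" for t
  proof -
    have t: "\<bar>t\<bar> < 1" using that by auto
    interpret m: mehler_convergent t x y 1 by (rule mehler_convergent_at_1[OF t])
    define a where "a = 1 - t\<^sup>2"
    have a: "a > 0" using pos[OF t] by (simp add: a_def)
    have G1: "m.G 1 = (x - t * y) * m.G 0 / a"
      using m.mehler_sum_recurrence[of 0] a by (simp add: a_def field_simps)
    have G2: "m.G 2 = ((x - t * y) * m.G 1 - m.G 0) / a"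
      using m.mehler_sum_recurrence[of 1] a by (simp add: a_def field_simps numeral_2_eq_2)
    define E where "E = (- y * (x - t * y) / a + t * (x - t * y)\<^sup>2 / a\<^sup>2) - t / a"
    have dE: "((\<lambda>t. (x - t * y)\<^sup>2 / (2 * (1 - t\<^sup>2)) + ln (1 - t\<^sup>2) / 2) has_field_derivative E) (at t)"
    proof -
      define u where "u = x - t * y"
      have da: "((\<lambda>t. 1 - t\<^sup>2) has_field_derivative - 2 * t) (at t)"
        by (auto intro!: derivative_eq_intros)
      have du: "((\<lambda>t. (x - t * y)\<^sup>2) has_field_derivative - 2 * y * u) (at t)"
        by (auto intro!: derivative_eq_intros simp: u_def)
      have quot: "((\<lambda>t. (x - t * y)\<^sup>2 / (2 * (1 - t\<^sup>2))) has_field_derivative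
          (- 2 * y * u * (2 * a) - u\<^sup>2 * (2 * (- 2 * t))) / (2 * a * (2 * a))) (at t)"
        using DERIV_divide[OF du DERIV_cmult[OF da, of 2]] a by (simp add: u_def a_def)
      have "((\<lambda>t. ln (1 - t\<^sup>2) / 2) has_field_derivative (- 2 * t) / a / 2) (at t)"
        using DERIV_cdivide[OF DERIV_chain2[OF DERIV_ln_divide da], of 2] a by (simp add: a_def)
      from DERIV_add[OF quot this] show ?thesis
        by (rule DERIV_cong) (use a in \<open>simp add: E_def u_def[symmetric] field_simps power2_eq_square\<close>)
    qed
    have "y * m.G 1 - t * m.G 2 = - E * m.G 0"
      unfolding G2 G1 E_def by (simp add: divide_inverse power2_eq_square algebra_simps)
    hence dG: "((\<lambda>t. mehler_sum 0 t x y 1) has_field_derivative - E * m.G 0) (at t)"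
      using mehler_sum_deriv[OF t, of x y] by simp
    have "(W has_field_derivative 0) (at t)"
      unfolding W_def by (rule DERIV_cong[OF DERIV_mult[OF dG DERIV_fun_exp[OF dE]]]) simp
    thus ?thesis by (rule has_field_derivative_at_within)
  qed
  then obtain k where k: "\<And>t. t \<in> {-1<..<1} \<Longrightarrow> W t = k"
    using has_field_derivative_zero_constant[of "{-1<..<1::real}" W] by auto
  interpret half: mehler_convergent "1 / 2" x y 1 by (rule mehler_convergent_at_1) simp
  have "W 0 = exp (x\<^sup>2 / 2)"
    using mehler_sum_continuous_at_0(2)[OF half.summable_mehler_term] by (simp add: W_def)
  moreover have "W \<rho> = W 0" using k[of 0] k[of \<rho>] \<rho> by (simp add: abs_less_iff)
  moreover have "exp (ln (1 - \<rho>\<^sup>2) / 2) = sqrt (1 - \<rho>\<^sup>2)"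
    using pos[OF \<rho>] by (simp add: powr_half_sqrt[symmetric] powr_def)
  ultimately have "mehler_sum 0 \<rho> x y 1 * (exp ((x - \<rho> * y)\<^sup>2 / (2 * (1 - \<rho>\<^sup>2))) * sqrt (1 - \<rho>\<^sup>2)) = exp (x\<^sup>2 / 2)"
    by (simp add: W_def exp_add)
  hence "mehler_sum 0 \<rho> x y 1 = exp (x\<^sup>2 / 2) / (exp ((x - \<rho> * y)\<^sup>2 / (2 * (1 - \<rho>\<^sup>2))) * sqrt (1 - \<rho>\<^sup>2))"
    using pos[OF \<rho>] by (subst nonzero_eq_divide_eq) auto
  thus ?thesis by (simp only: exp_diff divide_divide_eq_left)
qed

section \<open>Abel summation at the boundary of the disc\<close>

text \<open>Abel's limit theorem. Summation by parts writes the difference of the two sides as \<open>(1 - t) * (\<Sum>n. e n * t ^ n)\<close>, where \<open>e n\<close>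
is the error of the \<open>n\<close>-th partial sum. The finitely many large errors are damped by \<open>1 - t\<close>, and the
others contribute at most a small multiple of \<open>(1 - t) * (\<Sum>n. t ^ n) = 1\<close>.\<close>

theorem abel_limit:
  fixes a :: "nat \<Rightarrow> real"
  assumes "summable a"
  shows "((\<lambda>t. \<Sum>n. a n * t ^ n) \<longlongrightarrow> (\<Sum>n. a n)) (at_left 1)"
proof -
  define S where "S = (\<Sum>n. a n)"
  define e where "e n = (\<Sum>i\<le>n. a i) - S" for n
  define F where "F t = (\<Sum>n. e n * t ^ n)" for t
  have e0: "e \<longlonglongrightarrow> 0"
    using summable_LIMSEQ'[OF assms] unfolding e_def S_def[symmetric] by (rule LIM_zero)
  have key: "\<exists>B\<ge>0. \<forall>t\<in>{0<..<1}. summable (\<lambda>n. e n * t ^ n) \<and> \<bar>(1 - t) * F t\<bar> \<le> (1 - t) * B + \<epsilon> / 2" if \<epsilon>: "\<epsilon> > 0" for \<epsilon>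
  proof -
    have "eventually (\<lambda>n. \<bar>e n\<bar> < \<epsilon> / 2) sequentially"
      using order_tendstoD(2)[OF tendsto_rabs[OF e0], of "\<epsilon> / 2"] \<epsilon> by simp
    then obtain N where N: "\<And>n. n \<ge> N \<Longrightarrow> \<bar>e n\<bar> < \<epsilon> / 2" unfolding eventually_sequentially by blast
    define B where "B = (\<Sum>n<N. \<bar>e n\<bar>)"
    have "summable (\<lambda>n. e n * t ^ n) \<and> \<bar>(1 - t) * F t\<bar> \<le> (1 - t) * B + \<epsilon> / 2" if t: "t \<in> {0<..<1}" for t
    proof -
      have "(\<lambda>n. if n \<in> {..<N} then \<bar>e n\<bar> else 0) sums B" unfolding B_def by (rule sums_If_finite_set) simp
      moreover have "(\<lambda>n. t ^ n) sums (1 / (1 - t))" using t by (intro geometric_sums) auto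
      ultimately have sm: "(\<lambda>n. (if n \<in> {..<N} then \<bar>e n\<bar> else 0) + \<epsilon> / 2 * t ^ n) sums (B + \<epsilon> / 2 * (1 / (1 - t)))"
        by (intro sums_add sums_mult)
      have bd: "norm (e n * t ^ n) \<le> (if n \<in> {..<N} then \<bar>e n\<bar> else 0) + \<epsilon> / 2 * t ^ n" for n
      proof (cases "n < N")
        case True
        have "\<bar>e n\<bar> * t ^ n \<le> \<bar>e n\<bar> * 1" using t by (intro mult_left_mono power_le_one) auto
        moreover have "0 \<le> \<epsilon> / 2 * t ^ n" using t \<epsilon> by simp
        ultimately show ?thesis using True t by (simp add: abs_mult)
      next
        case False
        hence "\<bar>e n\<bar> \<le> \<epsilon> / 2" using N[of n] by simp
        hence "\<bar>e n\<bar> * t ^ n \<le> \<epsilon> / 2 * t ^ n" using t by (intro mult_right_mono) auto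
        thus ?thesis using False t by (simp add: abs_mult)
      qed
      have sn: "summable (\<lambda>n. norm (e n * t ^ n))"
        using summable_comparison_test'[OF sums_summable[OF sm], of 0 "\<lambda>n. norm (e n * t ^ n)"] bd by simp
      have "\<bar>F t\<bar> \<le> (\<Sum>n. norm (e n * t ^ n))" unfolding F_def using summable_norm[OF sn] by simp
      also have "\<dots> \<le> B + \<epsilon> / 2 * (1 / (1 - t))"
        using suminf_le[OF bd sn sums_summable[OF sm]] sums_unique[OF sm] by simp
      finally have "(1 - t) * \<bar>F t\<bar> \<le> (1 - t) * (B + \<epsilon> / 2 * (1 / (1 - t)))"
        using t by (intro mult_left_mono) auto
      also have "\<dots> = (1 - t) * B + \<epsilon> / 2" using t by (simp add: field_simps)
      finally show ?thesis using t summable_norm_cancel[OF sn] by (simp add: abs_mult)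
    qed
    moreover have "B \<ge> 0" unfolding B_def by (intro sum_nonneg) auto
    ultimately show ?thesis by blast
  qed
  have by_parts: "(\<Sum>n. a n * t ^ n) - S = (1 - t) * F t" if t: "t \<in> {0<..<1}" for t
  proof -
    have "summable (\<lambda>n. e n * t ^ n)" using key[of 1] t by auto
    hence F: "(\<lambda>n. e n * t ^ n) sums F t" unfolding F_def by (rule summable_sums)
    hence "(\<lambda>n. e (Suc n) * t ^ Suc n) sums (F t - e 0 * t ^ 0)"
      using sums_Suc_iff[of "\<lambda>n. e n * t ^ n"] by simp
    from sums_diff[OF this sums_mult[OF F, of t]]
    have "(\<lambda>n. e (Suc n) * t ^ Suc n - t * (e n * t ^ n)) sums (F t - e 0 - t * F t)" by simp
    moreover have "e (Suc n) * t ^ Suc n - t * (e n * t ^ n) = a (Suc n) * t ^ Suc n" for n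
      by (simp add: e_def algebra_simps)
    ultimately have "(\<lambda>n. a (Suc n) * t ^ Suc n) sums (F t - e 0 - t * F t)" by simp
    hence "(\<lambda>n. a n * t ^ n) sums (F t - e 0 - t * F t + a 0 * t ^ 0)"
      using sums_Suc[of "\<lambda>n. a n * t ^ n"] by blast
    from sums_unique[OF this] show ?thesis by (simp add: e_def algebra_simps)
  qed
  show ?thesis
  proof (rule tendstoI)
    fix \<epsilon> :: real assume \<epsilon>: "\<epsilon> > 0"
    from key[OF \<epsilon>] obtain B where
      B: "\<forall>t\<in>{0<..<1}. summable (\<lambda>n. e n * t ^ n) \<and> \<bar>(1 - t) * F t\<bar> \<le> (1 - t) * B + \<epsilon> / 2"
      by (elim exE conjE)
    have "((\<lambda>t. (1 - t) * B + \<epsilon> / 2) \<longlongrightarrow> (1 - 1) * B + \<epsilon> / 2) (at_left 1)" by (intro tendsto_intros)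
    hence "eventually (\<lambda>t. (1 - t) * B + \<epsilon> / 2 < \<epsilon>) (at_left 1)" by (rule order_tendstoD(2)) (use \<epsilon> in simp)
    moreover have "eventually (\<lambda>t. t \<in> {0<..<1::real}) (at_left 1)" by (rule eventually_at_left_real) simp
    ultimately show "eventually (\<lambda>t. dist (\<Sum>n. a n * t ^ n) (\<Sum>n. a n) < \<epsilon>) (at_left 1)"
    proof eventually_elim
      case (elim t)
      have "\<bar>(1 - t) * F t\<bar> < \<epsilon>" using conjunct2[OF bspec[OF B elim(2)]] elim(1) by (rule le_less_trans)
      thus ?case unfolding by_parts[OF elim(2), symmetric] dist_real_def S_def .
    qed
  qed
qed

text \<open>On the boundary the Mehler kernel is a delta distribution. By Abel's theorem a convergent series has the limit of the
kernel as its sum. Off the diagonal \<open>x = r * y\<close> the Gaussian factor beats the pole of \<open>1 / sqrt (1 - t\<^sup>2)\<close> and the limit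
is 0. On the diagonal the kernel is unbounded, so the series cannot converge.\<close>

theorem mehler_sum_boundary:
  assumes r: "r\<^sup>2 = 1" and sm: "summable (mehler_term 0 r x y 1)"
  shows "mehler_sum 0 r x y 1 = 0"
proof -
  define M where "M t = mehler_sum 0 (r * t) x y 1" for t
  have "mehler_term 0 (r * t) x y 1 = (\<lambda>n. mehler_term 0 r x y 1 n * t ^ n)" for t
    by (auto simp: mehler_term_def power_mult_distrib)
  hence lim: "(M \<longlongrightarrow> mehler_sum 0 r x y 1) (at_left 1)"
    using abel_limit[OF sm] unfolding M_def mehler_sum_def by simp
  have ev: "eventually (\<lambda>t. t \<in> {0<..<1::real}) (at_left 1)" by (rule eventually_at_left_real) simp
  have r1: "\<bar>r\<bar> = 1" using r by (metis abs_1 power2_eq_iff abs_minus_cancel power_one)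
  have M: "M t = exp (x\<^sup>2 / 2 - (x - r * t * y)\<^sup>2 / (2 * (1 - t\<^sup>2))) / sqrt (1 - t\<^sup>2)" if "t \<in> {0<..<1}" for t
  proof -
    have "(r * t)\<^sup>2 = t\<^sup>2" using r by (simp add: power_mult_distrib)
    thus ?thesis unfolding M_def using mehler_formula[of "r * t" x y] that r1 by (simp add: abs_mult)
  qed
  have pos: "1 - t\<^sup>2 > 0" if "t \<in> {0<..<1}" for t :: real using that by (simp add: abs_square_less_1)
  have sq: "((\<lambda>t. sqrt (1 - t\<^sup>2)) \<longlongrightarrow> sqrt (1 - 1\<^sup>2)) (at_left (1::real))" by (intro tendsto_intros)
  show ?thesis
  proof (cases "x = r * y")
    case True
    \<comment> \<open>A finite limit of \<open>M\<close> would force the remaining exponential factor, whose limit is positive, to tend to 0.\<close>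
    have "((\<lambda>t. sqrt (1 - t\<^sup>2) * M t) \<longlongrightarrow> 0) (at_left 1)"
      using tendsto_mult[OF sq lim] by simp
    moreover have "eventually (\<lambda>t. sqrt (1 - t\<^sup>2) * M t = exp (x\<^sup>2 / 2 - x\<^sup>2 * (1 - t) / (2 * (1 + t)))) (at_left 1)"
      using ev
    proof eventually_elim
      case (elim t)
      have "x - r * t * y = x * (1 - t)" using True by (simp add: algebra_simps)
      moreover have "(x * (1 - t))\<^sup>2 / (2 * (1 - t\<^sup>2)) = x\<^sup>2 * (1 - t) / (2 * (1 + t))"
      proof -
        have "1 - t\<^sup>2 = (1 - t) * (1 + t)" by (simp add: power2_eq_square algebra_simps)
        thus ?thesis using elim by (simp add: power_mult_distrib power2_eq_square)
      qed
      ultimately show ?case using M[OF elim] pos[OF elim] by simp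
    qed
    ultimately have "((\<lambda>t. exp (x\<^sup>2 / 2 - x\<^sup>2 * (1 - t) / (2 * (1 + t)))) \<longlongrightarrow> 0) (at_left 1)"
      by (rule Lim_transform_eventually)
    moreover have "((\<lambda>t. exp (x\<^sup>2 / 2 - x\<^sup>2 * (1 - t) / (2 * (1 + t)))) \<longlongrightarrow> exp (x\<^sup>2 / 2 - x\<^sup>2 * (1 - 1) / (2 * (1 + 1)))) (at_left 1)"
      by (intro tendsto_intros) auto
    ultimately have "exp (x\<^sup>2 / 2) = 0"
      using tendsto_unique[OF trivial_limit_at_left_real] by fastforce
    thus ?thesis by simp
  next
    case False
    \<comment> \<open>Half of the limit of \<open>(x - r * t * y)\<^sup>2\<close>, hence a lower bound for it near \<open>t = 1\<close>.\<close>
    define \<delta> where "\<delta> = (x - r * y)\<^sup>2 / 2"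
    have \<delta>: "\<delta> > 0" "\<delta> < (x - r * y)\<^sup>2" using False by (auto simp: \<delta>_def)
    have "((\<lambda>t. (x - r * t * y)\<^sup>2) \<longlongrightarrow> (x - r * 1 * y)\<^sup>2) (at_left 1)" by (intro tendsto_intros)
    hence evd: "eventually (\<lambda>t. (x - r * t * y)\<^sup>2 > \<delta>) (at_left 1)" using \<delta> by (intro order_tendstoD(1)) auto
    have "eventually (\<lambda>t. norm (M t) \<le> exp (x\<^sup>2 / 2) * (2 / \<delta>) * sqrt (1 - t\<^sup>2)) (at_left 1)"
      using ev evd
    proof eventually_elim
      case (elim t)
      define a where "a = 1 - t\<^sup>2"
      have a: "a > 0" using pos[OF elim(1)] by (simp add: a_def)
      define w where "w = (x - r * t * y)\<^sup>2 / (2 * a)"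
      have w: "\<delta> / (2 * a) \<le> w" unfolding w_def using elim(2) a by (intro divide_right_mono) auto
      have w0: "0 < \<delta> / (2 * a)" using \<delta> a by simp
      \<comment> \<open>This crude bound on \<open>exp (- w)\<close> already gains a full power of \<open>1 - t\<^sup>2\<close>, whereas the denominator \<open>sqrt a\<close> loses half a power.\<close>
      have "w \<le> exp w" using exp_ge_add_one_self[of w] by linarith
      hence "exp (- w) \<le> 2 * a / \<delta>"
        using w w0 \<delta> a le_imp_inverse_le[of "\<delta> / (2 * a)" "exp w"] by (simp add: exp_minus)
      hence "exp (x\<^sup>2 / 2) * exp (- w) / sqrt a \<le> exp (x\<^sup>2 / 2) * (2 * a / \<delta>) / sqrt a"
        using a by (intro divide_right_mono mult_left_mono) auto
      also have "\<dots> = exp (x\<^sup>2 / 2) * (2 / \<delta>) * (a / sqrt a)" by simp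
      also have "a / sqrt a = sqrt a" using a by (simp add: real_div_sqrt)
      finally have "exp (x\<^sup>2 / 2) * exp (- w) / sqrt a \<le> exp (x\<^sup>2 / 2) * (2 / \<delta>) * sqrt a" .
      moreover have "M t = exp (x\<^sup>2 / 2) * exp (- w) / sqrt a"
        using M[OF elim(1)] by (simp add: w_def a_def mult_exp_exp)
      ultimately show ?case using a by (simp add: a_def)
    qed
    moreover have "((\<lambda>t. exp (x\<^sup>2 / 2) * (2 / \<delta>) * sqrt (1 - t\<^sup>2)) \<longlongrightarrow> 0) (at_left 1)"
      using tendsto_mult[OF tendsto_const sq, of "exp (x\<^sup>2 / 2) * (2 / \<delta>)"] by simp
    ultimately have "(M \<longlongrightarrow> 0) (at_left 1)" by (rule Lim_null_comparison)
    thus ?thesis using lim tendsto_unique[OF trivial_limit_at_left_real] by blast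
  qed
qed

section \<open>The exchange identity\<close>

text \<open>At \<open>q = 1\<close> the conditional polynomials are Hermite polynomials in the variable standardized by the
conditional mean \<open>\<rho> * y\<close> and the conditional variance \<open>1 - \<rho>\<^sup>2\<close>.\<close>

lemma al_salam_chihara_at_1:
  assumes "\<bar>\<rho>\<bar> < 1"
  shows "al_salam_chihara n x y \<rho> 1 =
    sqrt (1 - \<rho>\<^sup>2) ^ n * q_hermite n ((x - \<rho> * y) / sqrt (1 - \<rho>\<^sup>2)) 1"
proof -
  define s where "s = sqrt (1 - \<rho>\<^sup>2)"
  define u where "u = (x - \<rho> * y) / s"
  have "1 - \<rho>\<^sup>2 > 0" using assms by (simp add: abs_square_less_1)
  hence s: "s > 0" "1 - \<rho>\<^sup>2 = s * s" by (simp_all add: s_def)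
  have su: "x - \<rho> * y = s * u" using s by (simp add: u_def)
  have "al_salam_chihara n x y \<rho> 1 = s ^ n * q_hermite n u 1 \<and>
        al_salam_chihara (Suc n) x y \<rho> 1 = s ^ Suc n * q_hermite (Suc n) u 1"
  proof (induction n)
    case (Suc n)
    have "al_salam_chihara (Suc (Suc n)) x y \<rho> 1 = (x - \<rho> * y) * al_salam_chihara (Suc n) x y \<rho> 1
        - (1 - \<rho>\<^sup>2) * real (Suc n) * al_salam_chihara n x y \<rho> 1" by simp
    also have "\<dots> = s ^ Suc (Suc n) * q_hermite (Suc (Suc n)) u 1"
      unfolding conjunct1[OF Suc.IH] conjunct2[OF Suc.IH] su s(2) q_hermite_Suc[of "Suc n"]
      by (simp add: algebra_simps del: of_nat_Suc)
    finally show ?case using Suc.IH by blast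
  qed (simp add: su)
  thus ?thesis by (simp add: s_def u_def)
qed

text \<open>The determinant of the correlation matrix of three variables with the given pairwise correlations.\<close>

definition gram_det :: "real \<Rightarrow> real \<Rightarrow> real \<Rightarrow> real" where
  "gram_det \<rho>12 \<rho>13 \<rho>23 = 1 + 2 * \<rho>12 * \<rho>13 * \<rho>23 - \<rho>12\<^sup>2 - \<rho>13\<^sup>2 - \<rho>23\<^sup>2"

text \<open>The correlation of the first two variables given the third one.\<close>

definition partial_corr :: "real \<Rightarrow> real \<Rightarrow> real \<Rightarrow> real" where
  "partial_corr \<rho>12 \<rho>13 \<rho>23 = (\<rho>12 - \<rho>13 * \<rho>23) / (sqrt (1 - \<rho>13\<^sup>2) * sqrt (1 - \<rho>23\<^sup>2))"

lemma one_minus_partial_corr_sq: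
  assumes "\<bar>\<rho>13\<bar> < 1" "\<bar>\<rho>23\<bar> < 1"
  shows "1 - (partial_corr \<rho>12 \<rho>13 \<rho>23)\<^sup>2 = gram_det \<rho>12 \<rho>13 \<rho>23 / ((1 - \<rho>13\<^sup>2) * (1 - \<rho>23\<^sup>2))"
proof -
  have pos: "1 - \<rho>13\<^sup>2 > 0" "1 - \<rho>23\<^sup>2 > 0" using assms by (simp_all add: abs_square_less_1)
  have "(partial_corr \<rho>12 \<rho>13 \<rho>23)\<^sup>2 = (\<rho>12 - \<rho>13 * \<rho>23)\<^sup>2 / ((1 - \<rho>13\<^sup>2) * (1 - \<rho>23\<^sup>2))"
    using pos by (simp add: partial_corr_def power_divide power_mult_distrib)
  hence "1 - (partial_corr \<rho>12 \<rho>13 \<rho>23)\<^sup>2 =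
     ((1 - \<rho>13\<^sup>2) * (1 - \<rho>23\<^sup>2) - (\<rho>12 - \<rho>13 * \<rho>23)\<^sup>2) / ((1 - \<rho>13\<^sup>2) * (1 - \<rho>23\<^sup>2))"
    using pos by (simp add: diff_divide_distrib)
  also have "(1 - \<rho>13\<^sup>2) * (1 - \<rho>23\<^sup>2) - (\<rho>12 - \<rho>13 * \<rho>23)\<^sup>2 = gram_det \<rho>12 \<rho>13 \<rho>23"
    by (simp add: gram_det_def power2_eq_square algebra_simps)
  finally show ?thesis .
qed

lemma asc_term_at_1:
  assumes "\<bar>\<rho>13\<bar> < 1" "\<bar>\<rho>23\<bar> < 1"
  shows "asc_term \<rho>12 \<rho>13 \<rho>23 x1 x2 x3 1 =
    mehler_term 0 (partial_corr \<rho>12 \<rho>13 \<rho>23)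
      ((x1 - \<rho>13 * x3) / sqrt (1 - \<rho>13\<^sup>2)) ((x2 - \<rho>23 * x3) / sqrt (1 - \<rho>23\<^sup>2)) 1"
proof
  fix n
  define s t where "s = sqrt (1 - \<rho>13\<^sup>2)" and "t = sqrt (1 - \<rho>23\<^sup>2)"
  have "1 - \<rho>13\<^sup>2 > 0" "1 - \<rho>23\<^sup>2 > 0" using assms by (simp_all add: abs_square_less_1)
  hence st: "s > 0" "t > 0" "1 - \<rho>13\<^sup>2 = s * s" "1 - \<rho>23\<^sup>2 = t * t" by (simp_all add: s_def t_def)
  show "asc_term \<rho>12 \<rho>13 \<rho>23 x1 x2 x3 1 n =
    mehler_term 0 (partial_corr \<rho>12 \<rho>13 \<rho>23)
      ((x1 - \<rho>13 * x3) / sqrt (1 - \<rho>13\<^sup>2)) ((x2 - \<rho>23 * x3) / sqrt (1 - \<rho>23\<^sup>2)) 1 n"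
    unfolding asc_term_def mehler_term_def al_salam_chihara_at_1[OF assms(1)] al_salam_chihara_at_1[OF assms(2)]
      partial_corr_def s_def[symmetric] t_def[symmetric]
    using st(1,2) by (simp add: q_poch_hom_def q_poch_def st(3,4) power_divide power_mult_distrib field_simps)
qed

text \<open>This is the density of \<open>x1\<close> given \<open>x2\<close> and \<open>x3\<close> divided by the density of \<open>x1\<close> given \<open>x3\<close>.
The squared expression is, up to the factor \<open>1 - \<rho>23\<^sup>2\<close>, the deviation of \<open>x1\<close> from its conditional mean given
\<open>x2\<close> and \<open>x3\<close>. Written in this form, the second exponent and the determinant are visibly symmetric under the exchange of
the indices 2 and 3.\<close>

lemma asc_series_at_1:
  assumes \<rho>: "\<bar>\<rho>13\<bar> < 1" "\<bar>\<rho>23\<bar> < 1" and \<Delta>: "gram_det \<rho>12 \<rho>13 \<rho>23 > 0"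
  shows "summable (asc_term \<rho>12 \<rho>13 \<rho>23 x1 x2 x3 1)"
    "(\<Sum>s. asc_term \<rho>12 \<rho>13 \<rho>23 x1 x2 x3 1 s) =
      exp ((x1 - \<rho>13 * x3)\<^sup>2 / (2 * (1 - \<rho>13\<^sup>2))
        - ((1 - \<rho>23\<^sup>2) * x1 - (\<rho>12 - \<rho>13 * \<rho>23) * x2 - (\<rho>13 - \<rho>12 * \<rho>23) * x3)\<^sup>2
            / (2 * (1 - \<rho>23\<^sup>2) * gram_det \<rho>12 \<rho>13 \<rho>23))
      * sqrt ((1 - \<rho>13\<^sup>2) * (1 - \<rho>23\<^sup>2) / gram_det \<rho>12 \<rho>13 \<rho>23)"
proof -
  define D where "D = gram_det \<rho>12 \<rho>13 \<rho>23"
  define s t where "s = sqrt (1 - \<rho>13\<^sup>2)" and "t = sqrt (1 - \<rho>23\<^sup>2)"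
  have pos: "1 - \<rho>13\<^sup>2 > 0" "1 - \<rho>23\<^sup>2 > 0" using \<rho> by (simp_all add: abs_square_less_1)
  hence st: "s > 0" "t > 0" "1 - \<rho>13\<^sup>2 = s\<^sup>2" "1 - \<rho>23\<^sup>2 = t\<^sup>2" by (simp_all add: s_def t_def)
  define r where "r = partial_corr \<rho>12 \<rho>13 \<rho>23"
  define u v where "u = (x1 - \<rho>13 * x3) / s" and "v = (x2 - \<rho>23 * x3) / t"
  have r: "1 - r\<^sup>2 = D / (s\<^sup>2 * t\<^sup>2)"
    unfolding r_def one_minus_partial_corr_sq[OF \<rho>] st(3,4) D_def ..
  have D: "D > 0" using \<Delta> by (simp add: D_def)
  have "1 - r\<^sup>2 > 0" unfolding r using D st by simp
  hence r1: "\<bar>r\<bar> < 1" by (simp add: abs_square_less_1)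
  interpret m: mehler_convergent r u v 1 by (rule mehler_convergent_at_1[OF r1])
  have eq: "asc_term \<rho>12 \<rho>13 \<rho>23 x1 x2 x3 1 = mehler_term 0 r u v 1"
    using asc_term_at_1[OF \<rho>] by (simp add: r_def u_def v_def s_def t_def)
  show "summable (asc_term \<rho>12 \<rho>13 \<rho>23 x1 x2 x3 1)" unfolding eq by (rule m.summable_mehler_term)
  define N where "N = t\<^sup>2 * x1 - (\<rho>12 - \<rho>13 * \<rho>23) * x2 - (\<rho>13 - \<rho>12 * \<rho>23) * x3"
  have "N = t\<^sup>2 * (x1 - \<rho>13 * x3) - (\<rho>12 - \<rho>13 * \<rho>23) * (x2 - \<rho>23 * x3)"
    unfolding N_def st(4)[symmetric] by (simp add: power2_eq_square algebra_simps)
  moreover have "a / s - c / (s * t) * (b / t) = (t\<^sup>2 * a - c * b) / (s * t\<^sup>2)" for a b c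
    using st(1,2) by (simp add: power2_eq_square field_simps)
  ultimately have dev: "u - r * v = N / (s * t\<^sup>2)"
    unfolding u_def v_def r_def partial_corr_def s_def[symmetric] t_def[symmetric] by simp
  have e2: "(u - r * v)\<^sup>2 / (2 * (1 - r\<^sup>2)) = N\<^sup>2 / (2 * t\<^sup>2 * D)"
    unfolding r dev using st(1,2) D by (simp add: power2_eq_square field_simps)
  have e1: "u\<^sup>2 / 2 = (x1 - \<rho>13 * x3)\<^sup>2 / (2 * s\<^sup>2)" by (simp add: u_def power_divide)
  have e3: "1 / sqrt (1 - r\<^sup>2) = sqrt (s\<^sup>2 * t\<^sup>2 / D)" unfolding r by (simp add: real_sqrt_divide)
  have "(\<Sum>n. asc_term \<rho>12 \<rho>13 \<rho>23 x1 x2 x3 1 n) = mehler_sum 0 r u v 1" unfolding eq mehler_sum_def ..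
  also have "\<dots> = exp (u\<^sup>2 / 2 - (u - r * v)\<^sup>2 / (2 * (1 - r\<^sup>2))) * (1 / sqrt (1 - r\<^sup>2))"
    unfolding mehler_formula[OF r1] by simp
  finally show "(\<Sum>s. asc_term \<rho>12 \<rho>13 \<rho>23 x1 x2 x3 1 s) =
      exp ((x1 - \<rho>13 * x3)\<^sup>2 / (2 * (1 - \<rho>13\<^sup>2))
        - ((1 - \<rho>23\<^sup>2) * x1 - (\<rho>12 - \<rho>13 * \<rho>23) * x2 - (\<rho>13 - \<rho>12 * \<rho>23) * x3)\<^sup>2
            / (2 * (1 - \<rho>23\<^sup>2) * gram_det \<rho>12 \<rho>13 \<rho>23))
      * sqrt ((1 - \<rho>13\<^sup>2) * (1 - \<rho>23\<^sup>2) / gram_det \<rho>12 \<rho>13 \<rho>23)"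
    unfolding e1 e2 e3 st(3,4) D_def[symmetric] N_def .
qed

lemma asc_series_degenerate:
  assumes \<rho>: "\<bar>\<rho>13\<bar> < 1" "\<bar>\<rho>23\<bar> < 1" and \<Delta>: "gram_det \<rho>12 \<rho>13 \<rho>23 = 0"
    and sm: "summable (asc_term \<rho>12 \<rho>13 \<rho>23 x1 x2 x3 1)"
  shows "(\<Sum>s. asc_term \<rho>12 \<rho>13 \<rho>23 x1 x2 x3 1 s) = 0"
proof -
  have "(partial_corr \<rho>12 \<rho>13 \<rho>23)\<^sup>2 = 1"
    using one_minus_partial_corr_sq[OF \<rho>, of \<rho>12] \<Delta> by simp
  from mehler_sum_boundary[OF this] sm show ?thesis
    unfolding asc_term_at_1[OF \<rho>] mehler_sum_def .
qed

lemma gram_det_swap: "gram_det \<rho>13 \<rho>12 \<rho>23 = gram_det \<rho>12 \<rho>13 \<rho>23"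
  by (simp add: gram_det_def)

text \<open>The symmetric parts of the two closed forms cancel, and the rest is the quotient of the two normal densities.\<close>

theorem asc_series_exchange_at_1:
  assumes \<rho>: "\<bar>\<rho>12\<bar> < 1" "\<bar>\<rho>13\<bar> < 1" "\<bar>\<rho>23\<bar> < 1" and \<Delta>: "gram_det \<rho>12 \<rho>13 \<rho>23 > 0"
  shows "(\<Sum>s. asc_term \<rho>12 \<rho>13 \<rho>23 x1 x2 x3 1 s) =
    f_CN_ratio x1 x2 \<rho>12 x3 \<rho>13 1 * (\<Sum>k. asc_term \<rho>13 \<rho>12 \<rho>23 x1 x3 x2 1 k)"
proof -
  have pos: "1 - \<rho>12\<^sup>2 > 0" "1 - \<rho>13\<^sup>2 > 0" using \<rho> by (simp_all add: abs_square_less_1)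
  define D where "D = gram_det \<rho>12 \<rho>13 \<rho>23"
  define X where "X = ((1 - \<rho>23\<^sup>2) * x1 - (\<rho>12 - \<rho>13 * \<rho>23) * x2 - (\<rho>13 - \<rho>12 * \<rho>23) * x3)\<^sup>2 / (2 * (1 - \<rho>23\<^sup>2) * D)"
  have X': "((1 - \<rho>23\<^sup>2) * x1 - (\<rho>13 - \<rho>12 * \<rho>23) * x3 - (\<rho>12 - \<rho>13 * \<rho>23) * x2)\<^sup>2 / (2 * (1 - \<rho>23\<^sup>2) * D) = X"
    by (simp add: X_def algebra_simps)
  have l: "(\<Sum>s. asc_term \<rho>12 \<rho>13 \<rho>23 x1 x2 x3 1 s) =
      exp ((x1 - \<rho>13 * x3)\<^sup>2 / (2 * (1 - \<rho>13\<^sup>2)) - X) * sqrt ((1 - \<rho>13\<^sup>2) * (1 - \<rho>23\<^sup>2) / D)"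
    using asc_series_at_1(2)[OF \<rho>(2,3) \<Delta>, of x1 x2 x3] unfolding D_def[symmetric] X_def .
  have "gram_det \<rho>13 \<rho>12 \<rho>23 > 0" using \<Delta> by (simp only: gram_det_swap)
  from asc_series_at_1(2)[OF \<rho>(1,3) this, of x1 x3 x2]
  have rr: "(\<Sum>k. asc_term \<rho>13 \<rho>12 \<rho>23 x1 x3 x2 1 k) =
      exp ((x1 - \<rho>12 * x2)\<^sup>2 / (2 * (1 - \<rho>12\<^sup>2)) - X) * sqrt ((1 - \<rho>12\<^sup>2) * (1 - \<rho>23\<^sup>2) / D)"
    unfolding gram_det_swap D_def[symmetric] X' .
  have "exp (e13 - X) * sqrt (a13 * b / D) =
      1 / sqrt (2 * pi * a12) * exp (- e12) / (1 / sqrt (2 * pi * a13) * exp (- e13)) * (exp (e12 - X) * sqrt (a12 * b / D))"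
    if "a12 > 0" "a13 > 0" for e12 e13 a12 a13 b
    using that by (simp add: exp_diff exp_minus real_sqrt_mult real_sqrt_divide field_simps)
  from this[OF pos] show ?thesis unfolding l rr by (simp add: f_CN_ratio_def f_CN_def)
qed

theorem corollary2:
  fixes q \<rho>12 \<rho>13 \<rho>23 x1 x2 x3 :: real
  assumes "-1 < q" "q \<le> 1"
    and "\<rho>12 \<in> {-1<..<1}" "\<rho>13 \<in> {-1<..<1}" "\<rho>23 \<in> {-1<..<1}"
    and "1 + 2 * \<rho>12 * \<rho>13 * \<rho>23 - \<rho>12\<^sup>2 - \<rho>13\<^sup>2 - \<rho>23\<^sup>2 \<ge> 0"
    and "x1 \<in> q_support q" "x2 \<in> q_support q" "x3 \<in> q_support q"
  shows "(q < 1 \<or> 1 + 2 * \<rho>12 * \<rho>13 * \<rho>23 - \<rho>12\<^sup>2 - \<rho>13\<^sup>2 - \<rho>23\<^sup>2 > 0 \<longrightarrow>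
            summable (asc_term \<rho>12 \<rho>13 \<rho>23 x1 x2 x3 q) \<and>
            summable (asc_term \<rho>13 \<rho>12 \<rho>23 x1 x3 x2 q)) \<and>
         (summable (asc_term \<rho>12 \<rho>13 \<rho>23 x1 x2 x3 q) \<and>
          summable (asc_term \<rho>13 \<rho>12 \<rho>23 x1 x3 x2 q) \<longrightarrow>
            (\<Sum>s. asc_term \<rho>12 \<rho>13 \<rho>23 x1 x2 x3 q s) =
            f_CN_ratio x1 x2 \<rho>12 x3 \<rho>13 q * (\<Sum>k. asc_term \<rho>13 \<rho>12 \<rho>23 x1 x3 x2 q k))"
proof -
  have \<rho>: "\<bar>\<rho>12\<bar> < 1" "\<bar>\<rho>13\<bar> < 1" "\<bar>\<rho>23\<bar> < 1" using assms(3-5) by (simp_all add: abs_less_iff)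
  note x = assms(7-9)
  show ?thesis
  proof (cases "q < 1")
    case True
    hence q: "\<bar>q\<bar> < 1" using assms(1) by simp
    show ?thesis
      using asc_series_kibble_slepian(1)[OF q \<rho> x] asc_series_kibble_slepian(1)[OF q \<rho>(2,1,3) x(1,3,2)]
        asc_series_exchange_less_1[OF q \<rho> x] by blast
  next
    case False
    hence q: "q = 1" using assms(2) by simp
    show ?thesis
    proof (cases "gram_det \<rho>12 \<rho>13 \<rho>23 > 0")
      case True
      hence swapped: "gram_det \<rho>13 \<rho>12 \<rho>23 > 0" by (simp only: gram_det_swap)
      show ?thesis unfolding q
        by (intro conjI impI asc_series_at_1(1)[OF \<rho>(2,3) True] asc_series_at_1(1)[OF \<rho>(1,3) swapped]
            asc_series_exchange_at_1[OF \<rho> True])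
    next
      case False
      hence \<Delta>: "gram_det \<rho>12 \<rho>13 \<rho>23 = 0" using assms(6) by (simp add: gram_det_def)
      hence \<Delta>': "gram_det \<rho>13 \<rho>12 \<rho>23 = 0" by (simp only: gram_det_swap)
      have "(\<Sum>s. asc_term \<rho>12 \<rho>13 \<rho>23 x1 x2 x3 1 s) =
            f_CN_ratio x1 x2 \<rho>12 x3 \<rho>13 1 * (\<Sum>k. asc_term \<rho>13 \<rho>12 \<rho>23 x1 x3 x2 1 k)"
        if "summable (asc_term \<rho>12 \<rho>13 \<rho>23 x1 x2 x3 1)" "summable (asc_term \<rho>13 \<rho>12 \<rho>23 x1 x3 x2 1)"
        using asc_series_degenerate[OF \<rho>(2,3) \<Delta> that(1)] asc_series_degenerate[OF \<rho>(1,3) \<Delta>' that(2)] by simp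
      thus ?thesis unfolding q using \<Delta> by (simp add: gram_det_def)
    qed
  qed
qed

end
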